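(* Let $d\ge 1$, fix $m_0\in\mathbb{Z}^d\setminus\{0\}$, and let $\rho\in\mathbb{R}$ with $|m_0|^2+\rho>0$. Put $\lambda_0=(|m_0|^2+\rho)^{1/2}$. Suppose that $\rho$ satisfies $$|n\rho-k|>\gamma|n|^{-2d}\quad\text{for all } n,k\in\mathbb{Z},\ n\neq 0,$$ $$\Big|\sum_{k=0}^{10d}a_k\big(\sqrt{\rho+|m_0|^2}\big)^k\Big|>\gamma\Big(\sum_{k=0}^{10d}|a_k|\Big)^{-\tilde C}\quad\text{for all } (a_k)_{0\le k\le 10d}\in\mathbb{Z}^{10d+1}\setminus\{0\},$$ where $\gamma>0$ is a small constant and $\tilde C$ is a large number depending on $d$. Let $\alpha>0$ and $c>0$ be sufficiently small. If $\varepsilon>0$ is sufficiently small, then there is a Cantor type set $I_\varepsilon\subset[1,2]$ such that for every $p_0\in I_\varepsilon$ the periodic solution $$y_0(x,t)=p_0\cos(m_0\cdot x+\lambda_0 t)$$ of the linear equation $y_{tt}-\Delta y+\rho y=0$ on $\mathbb{T}^d$ persists (in the sense defined in the context, with this $c$) as a periodic solution of $$y_{tt}-\Delta y+\rho y+\varepsilon^2D^\alpha(y^3)=0,\qquad x\in\mathbb{T}^d.$$ The persisted periodic solution is of Gevrey smoothness, and its frequency $\lambda$ satisfies $$\lambda^2=|m_0|^2+\rho+\tfrac34\langle m_0\rangle^\alpha p_0^2\,\varepsilon^2+O(\varepsilon^{17/8}).$$ Moreover, $$\operatorname{mes}([1,2]\setminus I_\varepsilon)\to 0\quad\text{as }\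varepsilon\to0.$$
   Context: $\mathbb{T}^d=(\mathbb{R}/2\pi\mathbb{Z})^d$; $|\cdot|$ is the Euclidean norm; $\langle m\rangle=\big(1+\sum_{j=1}^d|m_j|^2\big)^{1/2}$ for $m\in\mathbb{Z}^d$; $|(m,n)|_1=\sum_{k=1}^d|m_k|+|n|$ for $(m,n)\in\mathbb{Z}^d\times\mathbb{Z}$; $\operatorname{mes}$ is Lebesgue measure. The fractional derivative of a smooth periodic function $f$ on $\mathbb{T}^d$ is $D^\alpha f(x)=\sum_{m\in\mathbb{Z}^d}\langle m\rangle^\alpha\hat f(m)e^{im\cdot x}$, where $\hat f(m)=(2\pi)^{-d}\int_{\mathbb{T}^d}f(x)e^{-im\cdot x}dx$. In the equation it acts in the variable $x$. Persistence: the solution $y_0=p_0\cos(m_0\cdot x+\lambda_0t)$ is said to persist if there are a real number $\lambda$ and real coefficients $\hat y(m,n)$ (depending on $p_0$ and $\varepsilon$) such that $$y(x,t)=\sum_{m\in\mathbb{Z}^d,\,n\in\mathbb{Z}}\hat y(m,n)\cos(m\cdot x+n\lambda t)$$ solves $y_{tt}-\Delta y+\rho y+\varepsilon^2D^\alpha(y^3)=0$, with (i) $\hat y(m_0,1)=\hat y(-m_0,-1)=\tfrac12p_0$; (ii) $\hat y(m,n)=\hat y(-m,-n)$ for all $(m,n)$; (iii) $\sum_{(m,n)\ne\pm(m_0,1)}|\hat y(m,n)|\,e^{|(m,n)|_1^{c}}<C\varepsilon^{1/8}$; (iv) $|\lambda-\lambda_0|<C\varepsilon$. Here $C$ depends only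 on $d,\alpha,m_0$. The number $\lambda$ is called the frequency of the persisted solution. Gevrey smoothness refers to the sub-exponential decay of Fourier coefficients expressed in (iii). "Cantor type set" is used descriptively by the paper, without further definition. Smallness is understood as follows: $\alpha$ and $c$ are small once $d,m_0,\rho,\gamma,\tilde C$ are fixed, and $\varepsilon$ is small once all these and $\alpha,c$ are fixed. *)

theory Defs
  imports "HOL-Analysis.Analysis"
begin

definition real_vec :: "int ^ 'd \<Rightarrow> real ^ 'd::finite" where
  "real_vec m = (\<chi> j. real_of_int (m $ j))"

definition bracket :: "int ^ 'd::finite \<Rightarrow> real" where
  "bracket m = sqrt (1 + (\<Sum>j\<in>UNIV. \<bar>real_of_int (m $ j)\<bar>\<^sup>2))"

definition norm1 :: "int ^ 'd::finite \<Rightarrow> int \<Rightarrow> real" where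
  "norm1 m n = (\<Sum>k\<in>UNIV. \<bar>real_of_int (m $ k)\<bar>) + \<bar>real_of_int n\<bar>"

text \<open>Functions on the torus are represented by functions on the whole space that are
  \<open>2 * pi\<close>-periodic in every coordinate; the torus integral is the integral over the period cell.\<close>

definition fourier_coeff :: "(real ^ 'd::finite \<Rightarrow> complex) \<Rightarrow> int ^ 'd \<Rightarrow> complex" where
  "fourier_coeff f m =
     complex_of_real (1 / (2 * pi) ^ CARD('d)) *
     integral (cbox 0 (\<chi> j. 2 * pi)) (\<lambda>x. f x * exp (- \<i> * complex_of_real (real_vec m \<bullet> x)))"

text \<open>Only meaningful when the series converges absolutely, as it does for smooth periodic \<open>f\<close>
  (otherwise \<^const>\<open>infsum\<close> returns 0).\<close>

definition frac_deriv :: "real \<Rightarrow> (real ^ 'd::finite \<Rightarrow> complex) \<Rightarrow> real ^ 'd \<Rightarrow> complex" where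
  "frac_deriv \<alpha> f x =
     (\<Sum>\<^sub>\<infinity>m\<in>UNIV. complex_of_real (bracket m powr \<alpha>) * fourier_coeff f m *
                  exp (\<i> * complex_of_real (real_vec m \<bullet> x)))"

definition dir_deriv :: "'a::euclidean_space \<Rightarrow> ('a \<Rightarrow> real) \<Rightarrow> 'a \<Rightarrow> real" where
  "dir_deriv v f z = frechet_derivative f (at z) v"

fun C_k :: "nat \<Rightarrow> ('a::euclidean_space \<Rightarrow> real) \<Rightarrow> bool" where
  "C_k 0 f \<longleftrightarrow> continuous_on UNIV f"
| "C_k (Suc k) f \<longleftrightarrow> (\<forall>z. f differentiable at z) \<and> (\<forall>b\<in>Basis. C_k k (dir_deriv b f))"

definition smooth :: "('a::euclidean_space \<Rightarrow> real) \<Rightarrow> bool" where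
  "smooth f \<longleftrightarrow> (\<forall>k. C_k k f)"

text \<open>Space-time functions take a pair \<open>(x, t)\<close>.\<close>

definition d_tt :: "((real ^ 'd::finite) \<times> real \<Rightarrow> real) \<Rightarrow> (real ^ 'd) \<times> real \<Rightarrow> real" where
  "d_tt y = dir_deriv (0, 1) (dir_deriv (0, 1) y)"

definition laplacian_x :: "((real ^ 'd::finite) \<times> real \<Rightarrow> real) \<Rightarrow> (real ^ 'd) \<times> real \<Rightarrow> real" where
  "laplacian_x y z = (\<Sum>j\<in>UNIV. dir_deriv (axis j 1, 0) (dir_deriv (axis j 1, 0) y) z)"

text \<open>Smooth (classical) solutions of \<open>y_tt - \<Delta>y + \<rho> y + \<epsilon>\<^sup>2 D\<^sup>\<alpha>(y\<^sup>3) = 0\<close> on the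
  torus, for all times. For \<open>\<epsilon> = 0\<close> this is the linear equation. The equation is stated in the
  complex numbers because \<^const>\<open>frac_deriv\<close> is complex-valued.\<close>

definition solves_nlw ::
  "real \<Rightarrow> real \<Rightarrow> real \<Rightarrow> ((real ^ 'd::finite) \<times> real \<Rightarrow> real) \<Rightarrow> bool" where
  "solves_nlw \<alpha> \<rho> \<epsilon> y \<longleftrightarrow>
     smooth y \<and>
     (\<forall>x t j. y (x + axis j (2 * pi), t) = y (x, t)) \<and>
     (\<forall>x t. complex_of_real (d_tt y (x, t) - laplacian_x y (x, t) + \<rho> * y (x, t)) +
            complex_of_real (\<epsilon>\<^sup>2) * frac_deriv \<alpha> (\<lambda>x'. complex_of_real (y (x', t) ^ 3)) x = 0)"

definition cos_wave :: "int ^ 'd::finite \<Rightarrow> real \<Rightarrow> real \<Rightarrow> (real ^ 'd) \<times> real \<Rightarrow> real" where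
  "cos_wave m0 \<omega>0 p0 = (\<lambda>(x, t). p0 * cos (real_vec m0 \<bullet> x + \<omega>0 * t))"

definition cos_series ::
  "(int ^ 'd::finite \<Rightarrow> int \<Rightarrow> real) \<Rightarrow> real \<Rightarrow> (real ^ 'd) \<times> real \<Rightarrow> real" where
  "cos_series yh \<omega> =
     (\<lambda>(x, t). \<Sum>\<^sub>\<infinity>(m, n)\<in>UNIV. yh m n * cos (real_vec m \<bullet> x + real_of_int n * \<omega> * t))"

text \<open>The solution \<open>cos_wave m0 \<omega>0 p0\<close> of the linear equation, with
  \<open>\<omega>0 = sqrt (|m0|\<^sup>2 + \<rho>)\<close>, persists as a solution of frequency \<open>\<omega>\<close>. The weighted sum bound
  includes summability explicitly, since \<^const>\<open>infsum\<close> is 0 on non-summable families; this bound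
  is the Gevrey smoothness of the persisted solution.\<close>

definition persists_with_frequency ::
  "real \<Rightarrow> real \<Rightarrow> real \<Rightarrow> real \<Rightarrow> real \<Rightarrow> int ^ 'd::finite \<Rightarrow> real \<Rightarrow> real \<Rightarrow> bool" where
  "persists_with_frequency C c \<alpha> \<rho> \<epsilon> m0 p0 \<omega> \<longleftrightarrow>
     (\<exists>yh :: int ^ 'd \<Rightarrow> int \<Rightarrow> real.
        solves_nlw \<alpha> \<rho> \<epsilon> (cos_series yh \<omega>) \<and>
        yh m0 1 = p0 / 2 \<and> yh (- m0) (- 1) = p0 / 2 \<and>
        (\<forall>m n. yh m n = yh (- m) (- n)) \<and>
        (let w = (\<lambda>(m, n). \<bar>yh m n\<bar> * exp (norm1 m n powr c));
             S = UNIV - {(m0, 1), (- m0, - 1)}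
         in w summable_on S \<and> infsum w S < C * \<epsilon> powr (1 / 8)) \<and>
        \<bar>\<omega> - sqrt ((norm (real_vec m0))\<^sup>2 + \<rho>)\<bar> < C * \<epsilon>)"

text \<open>For subsets of the real line, having empty interior is the same as being totally
  disconnected, so these are exactly the subsets homeomorphic to the Cantor set.\<close>

definition Cantor_type_set :: "real set \<Rightarrow> bool" where
  "Cantor_type_set S \<longleftrightarrow> S \<noteq> {} \<and> compact S \<and> (\<forall>x\<in>S. x islimpt S) \<and> interior S = {}"

end

theory Submission
  imports Defs
begin

text \<open>The equation has solutions that depend on \<open>x\<close> and \<open>t\<close> only through the single phase
  \<open>\<theta> = m0 \<bullet> x + \<omega> * t\<close>. For \<open>y(x, t) = u(\<theta>)\<close> with \<open>u(\<theta>) = \<Sum>k. a k * cos (k * \<theta>)\<close> and \<open>a\<close> even,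
  the equation becomes, mode by mode,
  \<open>(k\<^sup>2 * (|m0|\<^sup>2 - \<omega>\<^sup>2) + \<rho>) * a k + \<epsilon>\<^sup>2 * \<langle>k m0\<rangle>\<^sup>\<alpha> * (a \<star> a \<star> a) k = 0\<close>.
  At \<open>\<omega>\<^sup>2 = |m0|\<^sup>2 + \<rho>\<close> the divisor is \<open>\<rho> * (1 - k\<^sup>2)\<close>. It vanishes only for \<open>k = 1\<close> and \<open>k = -1\<close>, and
  it grows quadratically, faster than the multiplier \<open>\<langle>k m0\<rangle>\<^sup>\<alpha>\<close> with \<open>\<alpha> < 1\<close>. On this invariant
  family of functions there are therefore no small divisors once \<open>\<rho> \<noteq> 0\<close>, and \<open>\<rho> \<noteq> 0\<close> is the case
  \<open>n = 1\<close>, \<open>k = 0\<close> of the first Diophantine condition.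

  Prescribing \<open>a 1 = a (-1) = p / 2\<close>, the equation of the mode \<open>k = 1\<close> determines the frequency:
  \<open>\<omega>\<^sup>2 = |m0|\<^sup>2 + \<rho> + \<epsilon>\<^sup>2 * \<langle>m0\<rangle>\<^sup>\<alpha> * (a \<star> a \<star> a) 1 * (2 / p)\<close>. Substituting this into the other
  equations gives a fixed point problem whose nonlinear part is a polynomial in \<open>a\<close> with the factor
  \<open>\<epsilon>\<^sup>2\<close> (lemma \<open>mode_equation_solution\<close>). It is solved by contraction in the space of sequences bounded
  by a multiple of \<open>exp (- s * |k|) / (1 + k\<^sup>2)\<close>, which is closed under convolution. The exponential
  factor gives smoothness and, as \<open>c < 1\<close>, the Gevrey bound; the remaining modes are of size
  \<open>O(\<epsilon>\<^sup>2)\<close>. Replacing \<open>a\<close> by the single mode \<open>p * cos \<theta>\<close>, whose cube has first coefficient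
  \<open>3 / 8 * p ^ 3\<close>, changes \<open>\<omega>\<^sup>2\<close> by \<open>O(\<epsilon> ^ 4)\<close> and yields the frequency expansion.

  The lemma \<open>travelling_wave_solves\<close> turns solved mode equations into a classical solution; its
  main ingredient is the action of \<^const>\<open>frac_deriv\<close> on absolutely convergent trigonometric
  series. The lemma \<open>persistence\<close> combines both for every amplitude \<open>p\<close> in \<open>{1..2}\<close>. As no amplitude has to be
  excluded, any Cantor sets of measure tending to that of \<open>{1..2}\<close> serve as the sets of amplitudes.\<close>

section \<open>Weighted sequences and convolution\<close>

text \<open>For \<open>s > 0\<close> the exponential factor provides smoothness. It is merely submultiplicative; the factor
  \<open>1 / (1 + k\<^sup>2)\<close> makes the convolution of the weight with itself converge to at most a multiple of the weight.\<close>

definition weight :: "real \<Rightarrow> int \<Rightarrow> real" where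
  "weight s k = exp (- s * \<bar>real_of_int k\<bar>) / (1 + (real_of_int k)\<^sup>2)"

definition wbound :: "real \<Rightarrow> real \<Rightarrow> (int \<Rightarrow> real) \<Rightarrow> bool" where
  "wbound s A a \<longleftrightarrow> (\<forall>k. \<bar>a k\<bar> \<le> A * weight s k)"

definition conv :: "(int \<Rightarrow> real) \<Rightarrow> (int \<Rightarrow> real) \<Rightarrow> int \<Rightarrow> real" where
  "conv a b k = (\<Sum>\<^sub>\<infinity>j\<in>UNIV. a j * b (k - j))"

definition cube :: "(int \<Rightarrow> real) \<Rightarrow> int \<Rightarrow> real" where
  "cube a = conv a (conv a a)"

lemma one_plus_square_pos [simp]: "0 < 1 + (x::real)\<^sup>2"
  by (simp add: add_pos_nonneg)

lemma one_plus_square_neq0 [simp]: "1 + (x::real)\<^sup>2 \<noteq> 0"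
  using one_plus_square_pos[of x] by linarith

lemma weight_pos: "0 < weight s k"
  by (simp add: weight_def)

lemma weight_abs [simp]: "weight s \<bar>k\<bar> = weight s k"
  by (simp add: weight_def)

lemma weight_le_inverse_square:
  assumes "0 \<le> s"
  shows "weight s k \<le> 1 / (1 + (real_of_int k)\<^sup>2)"
  using assms by (simp add: weight_def divide_right_mono)

lemma weight_le_1:
  assumes "0 \<le> s"
  shows "weight s k \<le> 1"
proof -
  have "1 / (1 + (real_of_int k)\<^sup>2) \<le> 1" by simp
  with weight_le_inverse_square[OF assms, of k] show ?thesis by linarith
qed

lemma summable_inverse_square_int:
  "(\<lambda>k::int. 1 / (1 + (real_of_int k)\<^sup>2)) summable_on UNIV"
proof -
  have "summable (\<lambda>n::nat. inverse ((real n) ^ 2))"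
    using inverse_power_summable[of 2, where 'a = real] by simp
  then have "summable (\<lambda>n::nat. 1 / (1 + (real n)\<^sup>2))"
  proof (rule summable_comparison_test'[where N = 1])
    fix n :: nat assume "1 \<le> n"
    then have "1 / (1 + (real n)\<^sup>2) \<le> 1 / (real n)\<^sup>2"
      by (intro divide_left_mono) auto
    then show "norm (1 / (1 + (real n)\<^sup>2)) \<le> inverse ((real n) ^ 2)"
      by (simp add: divide_inverse)
  qed
  then have nat: "(\<lambda>n::nat. 1 / (1 + (real n)\<^sup>2)) summable_on UNIV"
    by (intro norm_summable_imp_summable_on) simp
  have "(\<lambda>k::int. 1 / (1 + (real_of_int k)\<^sup>2)) summable_on range int"
    using nat by (subst summable_on_reindex) (auto simp: o_def)
  moreover have "(\<lambda>k::int. 1 / (1 + (real_of_int k)\<^sup>2)) summable_on range (\<lambda>n. - int n)"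
    using nat by (subst summable_on_reindex) (auto simp: o_def inj_on_def)
  ultimately have "(\<lambda>k::int. 1 / (1 + (real_of_int k)\<^sup>2)) summable_on (range int \<union> range (\<lambda>n. - int n))"
    by (rule summable_on_union)
  moreover have "range int \<union> range (\<lambda>n. - int n) = UNIV"
  proof -
    have "k \<in> range int \<union> range (\<lambda>n. - int n)" for k
      by (cases k rule: int_cases2) auto
    then show ?thesis by blast
  qed
  ultimately show ?thesis by simp
qed

definition inverse_square_sum :: real where
  "inverse_square_sum = (\<Sum>\<^sub>\<infinity>k::int. 1 / (1 + (real_of_int k)\<^sup>2))"

lemma inverse_square_sum_nonneg: "0 \<le> inverse_square_sum"
  unfolding inverse_square_sum_def by (intro infsum_nonneg) simp

lemma inverse_square_shift:
  "(\<lambda>j::int. 1 / (1 + (real_of_int (k - j))\<^sup>2)) summable_on UNIV"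
  "(\<Sum>\<^sub>\<infinity>j::int. 1 / (1 + (real_of_int (k - j))\<^sup>2)) = inverse_square_sum"
proof -
  have bij: "bij_betw (\<lambda>j::int. k - j) UNIV UNIV"
    by (rule bij_betwI[of _ _ _ "\<lambda>j. k - j"]) auto
  show "(\<lambda>j::int. 1 / (1 + (real_of_int (k - j))\<^sup>2)) summable_on UNIV"
    using summable_on_reindex_bij_betw[OF bij, of "\<lambda>k. 1 / (1 + (real_of_int k)\<^sup>2)"]
      summable_inverse_square_int by simp
  show "(\<Sum>\<^sub>\<infinity>j::int. 1 / (1 + (real_of_int (k - j))\<^sup>2)) = inverse_square_sum"
    unfolding inverse_square_sum_def
    using infsum_reindex_bij_betw[OF bij, of "\<lambda>k. 1 / (1 + (real_of_int k)\<^sup>2)"] by simp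
qed

text \<open>Since \<open>1 + k\<^sup>2 \<le> 2 * (1 + j\<^sup>2) + 2 * (1 + (k - j)\<^sup>2)\<close>, dividing by the product of the two
  factors on the right splits \<open>1 / ((1 + j\<^sup>2) * (1 + (k - j)\<^sup>2))\<close> into two summable families, up to
  the factor \<open>1 / (1 + k\<^sup>2)\<close>. The exponentials are handled by the triangle inequality. Summing
  over \<open>j\<close> gives the algebra property \<open>wbound_conv\<close>.\<close>

lemma weight_product_le:
  assumes "0 \<le> s"
  shows "weight s j * weight s (k - j) \<le>
    weight s k * (2 * (1 / (1 + (real_of_int j)\<^sup>2)) + 2 * (1 / (1 + (real_of_int (k - j))\<^sup>2)))"
proof -
  define x y where "x = real_of_int j" and "y = real_of_int (k - j)"
  have k: "real_of_int k = x + y" by (simp add: x_def y_def)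
  have ge: "exp (- s * \<bar>x\<bar>) * exp (- s * \<bar>y\<bar>) \<le> exp (- s * \<bar>x + y\<bar>)"
  proof -
    have "s * \<bar>x + y\<bar> \<le> s * (\<bar>x\<bar> + \<bar>y\<bar>)"
      using assms by (intro mult_left_mono) auto
    then show ?thesis by (simp add: exp_add[symmetric] algebra_simps)
  qed
  have sq: "1 + (x + y)\<^sup>2 \<le> 2 * (1 + x\<^sup>2) + 2 * (1 + y\<^sup>2)"
    using zero_le_power2[of "x - y"] by (simp add: power2_eq_square algebra_simps)
  have "1 / ((1 + x\<^sup>2) * (1 + y\<^sup>2)) \<le>
      (2 * (1 + x\<^sup>2) + 2 * (1 + y\<^sup>2)) / (1 + (x + y)\<^sup>2) * (1 / ((1 + x\<^sup>2) * (1 + y\<^sup>2)))"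
  proof -
    have "1 \<le> (2 * (1 + x\<^sup>2) + 2 * (1 + y\<^sup>2)) / (1 + (x + y)\<^sup>2)"
      using sq by (simp add: le_divide_eq)
    then show ?thesis
      by (metis (no_types, lifting) mult_right_mono mult_1 zero_le_divide_1_iff
          mult_nonneg_nonneg less_imp_le one_plus_square_pos)
  qed
  also have "\<dots> = (2 * (1 / (1 + x\<^sup>2)) + 2 * (1 / (1 + y\<^sup>2))) / (1 + (x + y)\<^sup>2)"
  proof -
    have "X \<noteq> 0 \<Longrightarrow> Y \<noteq> 0 \<Longrightarrow> Z \<noteq> 0 \<Longrightarrow>
      (2 * X + 2 * Y) / Z * (1 / (X * Y)) = (2 * (1 / X) + 2 * (1 / Y)) / Z" for X Y Z :: real
      by (simp add: divide_simps)
    then show ?thesis by (metis one_plus_square_neq0)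
  qed
  finally have frac: "1 / ((1 + x\<^sup>2) * (1 + y\<^sup>2)) \<le>
    (2 * (1 / (1 + x\<^sup>2)) + 2 * (1 / (1 + y\<^sup>2))) / (1 + (x + y)\<^sup>2)" .
  have "weight s j * weight s (k - j) =
      exp (- s * \<bar>x\<bar>) * exp (- s * \<bar>y\<bar>) * (1 / ((1 + x\<^sup>2) * (1 + y\<^sup>2)))"
    by (simp add: weight_def x_def y_def)
  also have "\<dots> \<le> exp (- s * \<bar>x + y\<bar>) *
      ((2 * (1 / (1 + x\<^sup>2)) + 2 * (1 / (1 + y\<^sup>2))) / (1 + (x + y)\<^sup>2))"
    using ge frac by (intro mult_mono) auto
  also have "\<dots> = weight s k * (2 * (1 / (1 + x\<^sup>2)) + 2 * (1 / (1 + y\<^sup>2)))"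
    by (simp add: weight_def k)
  finally show ?thesis by (simp add: x_def y_def)
qed

lemma wbound_nonneg: "wbound s A a \<Longrightarrow> 0 \<le> A"
  unfolding wbound_def using weight_pos[of s 0]
  by (metis abs_ge_zero order_trans zero_le_mult_iff not_less)

lemma wboundD: "wbound s A a \<Longrightarrow> \<bar>a k\<bar> \<le> A * weight s k"
  by (simp add: wbound_def)

lemma wbound_mono: "wbound s A a \<Longrightarrow> A \<le> B \<Longrightarrow> wbound s B a"
  unfolding wbound_def
  by (meson mult_right_mono order_trans less_imp_le weight_pos)

lemma wbound_add:
  assumes "wbound s A a" "wbound s B b"
  shows "wbound s (A + B) (\<lambda>k. a k + b k)"
  unfolding wbound_def
proof
  fix k
  show "\<bar>a k + b k\<bar> \<le> (A + B) * weight s k"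
    using wboundD[OF assms(1), of k] wboundD[OF assms(2), of k] abs_triangle_ineq[of "a k" "b k"]
    unfolding distrib_right by linarith
qed

lemma wbound_summable:
  assumes "0 \<le> s" "wbound s A a"
  shows "(\<lambda>k. \<bar>a k\<bar>) summable_on UNIV"
proof -
  have "norm (a k) \<le> A * (1 / (1 + (real_of_int k)\<^sup>2))" for k
    unfolding real_norm_def using wboundD[OF assms(2)]
      mult_left_mono[OF weight_le_inverse_square[OF assms(1)] wbound_nonneg[OF assms(2)]]
    by (rule order_trans)
  then have "(\<lambda>k. norm (a k)) summable_on UNIV"
    by (intro Infinite_Sum.abs_summable_on_comparison_test'[OF summable_on_cmult_right[OF summable_inverse_square_int]])
  then show ?thesis by simp
qed

lemma conv_term_bound:
  assumes "0 \<le> s" "wbound s A a" "wbound s B b"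
  shows "\<bar>a j * b (k - j)\<bar> \<le> A * B * weight s k *
    (2 * (1 / (1 + (real_of_int j)\<^sup>2)) + 2 * (1 / (1 + (real_of_int (k - j))\<^sup>2)))"
proof -
  have "\<bar>a j * b (k - j)\<bar> \<le> (A * weight s j) * (B * weight s (k - j))"
    unfolding abs_mult
    using wboundD[OF assms(2), of j] wboundD[OF assms(3), of "k - j"]
    by (intro mult_mono) (auto intro: order_trans[OF abs_ge_zero])
  also have "\<dots> = A * B * (weight s j * weight s (k - j))" by simp
  also have "\<dots> \<le> A * B * (weight s k *
    (2 * (1 / (1 + (real_of_int j)\<^sup>2)) + 2 * (1 / (1 + (real_of_int (k - j))\<^sup>2))))"
    using weight_product_le[OF assms(1)] wbound_nonneg[OF assms(2)] wbound_nonneg[OF assms(3)]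
    by (intro mult_left_mono) auto
  finally show ?thesis by (simp only: mult.assoc)
qed

lemma conv_majorant_summable:
  "(\<lambda>j::int. K * (2 * (1 / (1 + (real_of_int j)\<^sup>2)) + 2 * (1 / (1 + (real_of_int (k - j))\<^sup>2))))
    summable_on UNIV" for K :: real
  by (intro summable_on_cmult_right summable_on_add summable_inverse_square_int inverse_square_shift)

lemma conv_summable:
  assumes "0 \<le> s" "wbound s A a" "wbound s B b"
  shows "(\<lambda>j. \<bar>a j * b (k - j)\<bar>) summable_on UNIV" "(\<lambda>j. a j * b (k - j)) summable_on UNIV"
proof -
  have "(\<lambda>j. norm (a j * b (k - j))) summable_on UNIV"
    using conv_term_bound[OF assms]
    by (intro Infinite_Sum.abs_summable_on_comparison_test'[OF conv_majorant_summable[of "A * B * weight s k" k]]) auto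
  then show "(\<lambda>j. \<bar>a j * b (k - j)\<bar>) summable_on UNIV" "(\<lambda>j. a j * b (k - j)) summable_on UNIV"
    using summable_on_iff_abs_summable_on_real by auto
qed

lemma wbound_conv:
  assumes "0 \<le> s" "wbound s A a" "wbound s B b"
  shows "wbound s (4 * inverse_square_sum * A * B) (conv a b)"
  unfolding wbound_def
proof
  fix k
  let ?K = "A * B * weight s k"
  have "\<bar>conv a b k\<bar> \<le> (\<Sum>\<^sub>\<infinity>j. \<bar>a j * b (k - j)\<bar>)"
    unfolding conv_def using norm_infsum_bound[of "\<lambda>j. a j * b (k - j)" UNIV] conv_summable[OF assms]
    by simp
  also have "\<dots> \<le> (\<Sum>\<^sub>\<infinity>j::int. ?K *
      (2 * (1 / (1 + (real_of_int j)\<^sup>2)) + 2 * (1 / (1 + (real_of_int (k - j))\<^sup>2))))"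
    by (intro infsum_mono conv_summable[OF assms] conv_majorant_summable conv_term_bound[OF assms])
  also have "\<dots> = ?K * (2 * inverse_square_sum + 2 * inverse_square_sum)"
    by (simp only: infsum_cmult_right' infsum_add summable_on_cmult_right
        summable_inverse_square_int inverse_square_shift inverse_square_sum_def[symmetric])
  finally show "\<bar>conv a b k\<bar> \<le> 4 * inverse_square_sum * A * B * weight s k"
    by (simp add: algebra_simps)
qed

lemma wbound_cube:
  assumes "0 \<le> s" "wbound s A a"
  shows "wbound s (16 * inverse_square_sum\<^sup>2 * A ^ 3) (cube a)"
  using wbound_conv[OF assms wbound_conv[OF assms assms(2)]]
  by (simp add: cube_def power2_eq_square power3_eq_cube algebra_simps)

lemma wbound_diff:
  assumes "wbound s A a" "wbound s B b"
  shows "wbound s (A + B) (\<lambda>k. a k - b k)"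
  unfolding wbound_def
proof
  fix k
  show "\<bar>a k - b k\<bar> \<le> (A + B) * weight s k"
    using wboundD[OF assms(1), of k] wboundD[OF assms(2), of k] abs_triangle_ineq4[of "a k" "b k"]
    unfolding distrib_right by linarith
qed

lemma conv_diff:
  assumes "0 \<le> s" "wbound s A a" "wbound s A' a'" "wbound s B b" "wbound s B' b'"
  shows "conv a b k - conv a' b' k = conv (\<lambda>k. a k - a' k) b k + conv a' (\<lambda>k. b k - b' k) k"
proof -
  note s = conv_summable(2)[OF assms(1)]
  have "conv (\<lambda>k. a k - a' k) b k + conv a' b k = conv a b k"
    unfolding conv_def using s[OF wbound_diff[OF assms(2,3)] assms(4)] s[OF assms(3,4)]
    by (subst infsum_add[symmetric]) (auto simp: algebra_simps)
  moreover have "conv a' (\<lambda>k. b k - b' k) k + conv a' b' k = conv a' b k"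
    unfolding conv_def using s[OF assms(3) wbound_diff[OF assms(4,5)]] s[OF assms(3,5)]
    by (subst infsum_add[symmetric]) (auto simp: algebra_simps)
  ultimately show ?thesis by simp
qed

lemma wbound_conv_diff:
  assumes "0 \<le> s" "wbound s A a" "wbound s A a'" "wbound s B b" "wbound s B b'"
    and "wbound s D (\<lambda>k. a k - a' k)" "wbound s E (\<lambda>k. b k - b' k)"
  shows "wbound s (4 * inverse_square_sum * (D * B + A * E)) (\<lambda>k. conv a b k - conv a' b' k)"
proof -
  have "wbound s (4 * inverse_square_sum * D * B + 4 * inverse_square_sum * A * E)
     (\<lambda>k. conv (\<lambda>k. a k - a' k) b k + conv a' (\<lambda>k. b k - b' k) k)"
    using assms by (intro wbound_add wbound_conv) auto
  moreover have "(\<lambda>k. conv a b k - conv a' b' k) =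
      (\<lambda>k. conv (\<lambda>k. a k - a' k) b k + conv a' (\<lambda>k. b k - b' k) k)"
    using conv_diff[OF assms(1,2,3,4,5)] by auto
  ultimately show ?thesis by (simp add: algebra_simps)
qed

lemma wbound_cube_diff:
  assumes "0 \<le> s" "wbound s A a" "wbound s A a'" "wbound s D (\<lambda>k. a k - a' k)"
  shows "wbound s (48 * inverse_square_sum\<^sup>2 * A\<^sup>2 * D) (\<lambda>k. cube a k - cube a' k)"
  using wbound_conv_diff[OF assms(1-3) wbound_conv[OF assms(1,2,2)] wbound_conv[OF assms(1,3,3)]
      assms(4) wbound_conv_diff[OF assms(1,2,3,2,3,4,4)]]
  by (simp add: cube_def power2_eq_square algebra_simps)

lemma conv_even:
  assumes "\<And>k. a (- k) = a k" "\<And>k. b (- k) = b k"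
  shows "conv a b (- k) = conv a b k"
proof -
  have "b (- k - j) = b (k + j)" for j
  proof -
    have "- k - j = - (k + j)" by simp
    then show ?thesis using assms(2)[of "k + j"] by metis
  qed
  then show ?thesis
    unfolding conv_def using assms(1)
    by (intro infsum_reindex_bij_witness[of _ uminus uminus]) auto
qed

lemma cube_even:
  assumes "\<And>k. a (- k) = a k"
  shows "cube a (- k) = cube a k"
  unfolding cube_def by (intro conv_even assms)

lemma infsum_of_real_complex:
  assumes "f summable_on A"
  shows "(\<Sum>\<^sub>\<infinity>x\<in>A. complex_of_real (f x)) = complex_of_real (\<Sum>\<^sub>\<infinity>x\<in>A. f x)"
  using assms by (intro infsumI) (simp add: has_sum_of_real_iff has_sum_infsum)

text \<open>The absolutely convergent double series is summed along the lines \<open>i + j = k\<close>.\<close>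

lemma conv_cis:
  assumes "0 \<le> s" "wbound s A a" "wbound s B b"
  shows "(\<Sum>\<^sub>\<infinity>k. complex_of_real (a k) * cis (real_of_int k * \<theta>)) *
      (\<Sum>\<^sub>\<infinity>k. complex_of_real (b k) * cis (real_of_int k * \<theta>)) =
      (\<Sum>\<^sub>\<infinity>k. complex_of_real (conv a b k) * cis (real_of_int k * \<theta>))"
proof -
  define f where "f a k = complex_of_real (a k) * cis (real_of_int k * \<theta>)" for a :: "int \<Rightarrow> real" and k
  have nf: "norm (f a k) = \<bar>a k\<bar>" for a k by (simp add: f_def norm_mult)
  have sf: "(\<lambda>k. norm (f a k)) summable_on UNIV" "(\<lambda>k. norm (f b k)) summable_on UNIV"
    using wbound_summable[OF assms(1,2)] wbound_summable[OF assms(1,3)] by (simp_all add: nf)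
  have prod: "(\<lambda>(i, j). f a i * f b j) summable_on UNIV \<times> UNIV"
  proof (rule abs_summable_summable)
    have "(\<lambda>x. norm (case x of (i, j) \<Rightarrow> f a i * f b j)) summable_on (SIGMA i:UNIV. UNIV)"
      using sf by (subst Infinite_Sum.abs_summable_on_Sigma_iff)
        (auto simp: norm_mult infsum_cmult_right' infsum_nonneg
          intro!: summable_on_cmult_left summable_on_cmult_right)
    then show "(\<lambda>x. norm (case x of (i, j) \<Rightarrow> f a i * f b j)) summable_on UNIV \<times> UNIV" .
  qed
  have "(\<Sum>\<^sub>\<infinity>k. f a k) * (\<Sum>\<^sub>\<infinity>k. f b k) = (\<Sum>\<^sub>\<infinity>i. \<Sum>\<^sub>\<infinity>j. f a i * f b j)"
    by (simp add: infsum_cmult_left' infsum_cmult_right')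
  also have "\<dots> = (\<Sum>\<^sub>\<infinity>(i, j)\<in>UNIV \<times> UNIV. f a i * f b j)"
    using prod by (intro infsum_Sigma'_banach) auto
  also have "\<dots> = (\<Sum>\<^sub>\<infinity>(k, i)\<in>UNIV \<times> UNIV. f a i * f b (k - i))"
    by (intro infsum_reindex_bij_witness[of _ "\<lambda>(k, i). (i, k - i)" "\<lambda>(i, j). (i + j, i)"]) auto
  also have "\<dots> = (\<Sum>\<^sub>\<infinity>k. \<Sum>\<^sub>\<infinity>i. f a i * f b (k - i))"
  proof (intro infsum_Sigma'_banach[symmetric])
    have "(\<lambda>(i, j). f a i * f b j) summable_on UNIV \<times> UNIV \<longleftrightarrow>
      (\<lambda>(k, i). f a i * f b (k - i)) summable_on UNIV \<times> UNIV"
      by (intro summable_on_reindex_bij_witness[of _ "\<lambda>(k, i). (i, k - i)" "\<lambda>(i, j). (i + j, i)"]) auto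
    then show "(\<lambda>(k, i). f a i * f b (k - i)) summable_on UNIV \<times> UNIV"
      using prod by simp
  qed
  also have "\<dots> = (\<Sum>\<^sub>\<infinity>k. f (conv a b) k)"
  proof (intro infsum_cong)
    fix k
    have "f a i * f b (k - i) = complex_of_real (a i * b (k - i)) * cis (real_of_int k * \<theta>)" for i
      by (simp add: f_def cis_mult algebra_simps)
    then have "(\<Sum>\<^sub>\<infinity>i. f a i * f b (k - i)) =
        (\<Sum>\<^sub>\<infinity>i. complex_of_real (a i * b (k - i))) * cis (real_of_int k * \<theta>)"
      by (simp add: infsum_cmult_left')
    also have "(\<Sum>\<^sub>\<infinity>i. complex_of_real (a i * b (k - i))) = complex_of_real (conv a b k)"
      unfolding conv_def
      using infsum_of_real_complex[OF conv_summable(2)[OF assms]] .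
    finally show "(\<Sum>\<^sub>\<infinity>i. f a i * f b (k - i)) = f (conv a b) k" by (simp add: f_def)
  qed
  finally show ?thesis by (simp add: f_def)
qed

lemma cube_cis:
  assumes "0 \<le> s" "wbound s A a"
  shows "(\<Sum>\<^sub>\<infinity>k. complex_of_real (a k) * cis (real_of_int k * \<theta>)) ^ 3 =
      (\<Sum>\<^sub>\<infinity>k. complex_of_real (cube a k) * cis (real_of_int k * \<theta>))"
  unfolding cube_def power3_eq_cube
  by (simp only: conv_cis[OF assms wbound_conv[OF assms assms(2)], symmetric]
      conv_cis[OF assms assms(2), symmetric] mult.assoc)

definition single_mode :: "real \<Rightarrow> int \<Rightarrow> real" where
  "single_mode p k = (if \<bar>k\<bar> = 1 then p / 2 else 0)"

lemma wbound_single_mode: "wbound s (\<bar>p\<bar> / 2 / weight s 1) (single_mode p)"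
  unfolding wbound_def
proof
  fix k
  show "\<bar>single_mode p k\<bar> \<le> \<bar>p\<bar> / 2 / weight s 1 * weight s k"
  proof (cases "\<bar>k\<bar> = 1")
    case True
    then have "weight s k = weight s 1" using weight_abs[of s k] by simp
    then show ?thesis using True weight_pos[of s 1] by (simp add: single_mode_def)
  next
    case False
    then show ?thesis using weight_pos[of s 1] weight_pos[of s k] by (simp add: single_mode_def)
  qed
qed

lemma conv_single_mode: "conv (single_mode p) b k = p / 2 * (b (k - 1) + b (k + 1))"
proof -
  have "conv (single_mode p) b k = (\<Sum>\<^sub>\<infinity>j\<in>{1, -1}. single_mode p j * b (k - j))"
    unfolding conv_def by (intro infsum_cong_neutral) (auto simp: single_mode_def)
  then show ?thesis by (simp add: single_mode_def algebra_simps)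
qed

lemma cube_single_mode: "cube (single_mode p) 1 = 3 / 8 * p ^ 3"
  unfolding cube_def by (simp add: conv_single_mode single_mode_def power3_eq_cube)

section \<open>Solving the mode equations by contraction\<close>

text \<open>Cauchy sequences converge uniformly, and on the discrete domain \<^typ>\<open>int\<close> continuity of the
  limit is automatic.\<close>

lemma complete_bounded_sequences: "complete (UNIV :: (int \<Rightarrow>\<^sub>C real) set)"
  unfolding complete_def
proof safe
  fix f :: "nat \<Rightarrow> int \<Rightarrow>\<^sub>C real" assume "Cauchy f"
  then obtain g where "uniform_limit UNIV (\<lambda>n. apply_bcontfun (f n)) g sequentially"
    using uniformly_convergent_eq_cauchy[of "\<lambda>_. True" "\<lambda>n. apply_bcontfun (f n)"]
    unfolding Cauchy_def uniform_limit_sequentially_iff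
    by (metis dist_fun_lt_imp_dist_val_lt)
  then obtain l where "f \<longlonglongrightarrow> l"
    by (metis uniform_limit_bcontfunE sequentially_bot)
  then show "\<exists>l\<in>UNIV. f \<longlonglongrightarrow> l" by blast
qed

text \<open>Division by the weight identifies the sequences \<open>a\<close> with \<open>wbound s A a\<close> with the ball of radius
  \<open>A\<close> in a space of bounded functions, where the Banach fixed point theorem applies. Stating the
  contraction hypothesis through \<^const>\<open>wbound\<close> keeps the applications free of that space.\<close>

lemma weighted_contraction:
  fixes F :: "(int \<Rightarrow> real) \<Rightarrow> int \<Rightarrow> real"
  assumes "0 \<le> A"
    and maps: "\<And>a. wbound s A a \<Longrightarrow> wbound s A (F a)"
    and contr: "\<And>a a' D. wbound s A a \<Longrightarrow> wbound s A a' \<Longrightarrow> wbound s D (\<lambda>k. a k - a' k) \<Longrightarrow>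
      wbound s (D / 2) (\<lambda>k. F a k - F a' k)"
  shows "\<exists>a. wbound s A a \<and> F a = a"
proof -
  define dec :: "(int \<Rightarrow>\<^sub>C real) \<Rightarrow> int \<Rightarrow> real" where "dec b k = weight s k * apply_bcontfun b k" for b k
  define enc :: "(int \<Rightarrow> real) \<Rightarrow> int \<Rightarrow>\<^sub>C real" where "enc a = Bcontfun (\<lambda>k. a k / weight s k)" for a
  have w: "weight s k > 0" for k by (rule weight_pos)
  have enc: "apply_bcontfun (enc a) = (\<lambda>k. a k / weight s k)" if "wbound s B a" for B a
  proof -
    have "norm (a k / weight s k) \<le> B" for k
      using wboundD[OF that, of k] w[of k] by (simp add: divide_le_eq)
    then have "(\<lambda>k. a k / weight s k) \<in> bcontfun"
      by (intro bcontfun_normI[where b = B]) (simp_all add: continuous_on_discrete)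
    then show ?thesis unfolding enc_def by (rule Bcontfun_inverse)
  qed
  have dec_wbound: "wbound s B (dec b)" if "norm b \<le> B" for b B
    unfolding wbound_def
  proof
    fix k
    have "\<bar>apply_bcontfun b k\<bar> \<le> B" using norm_bounded[of b k] that by simp
    then show "\<bar>dec b k\<bar> \<le> B * weight s k"
      using w[of k] by (simp add: dec_def abs_mult mult.commute)
  qed
  have dec_diff: "wbound s (dist b b') (\<lambda>k. dec b k - dec b' k)" for b b'
  proof -
    have "(\<lambda>k. dec b k - dec b' k) = dec (b - b')" by (simp add: fun_eq_iff dec_def right_diff_distrib)
    then show ?thesis using dec_wbound[of "b - b'" "dist b b'"] by (simp add: dist_norm)
  qed
  have "\<exists>!b\<in>cball 0 A. (\<lambda>b. enc (F (dec b))) b = b"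
  proof (rule Banach_fix[where c = "1/2"])
    show "complete (cball 0 A :: (int \<Rightarrow>\<^sub>C real) set)"
      by (rule complete_closed_subset[OF closed_cball subset_UNIV complete_bounded_sequences])
    show "cball (0 :: int \<Rightarrow>\<^sub>C real) A \<noteq> {}" using assms(1) by simp
    have bd: "wbound s A (F (dec b))" if "b \<in> cball 0 A" for b
      using that by (intro maps dec_wbound) simp
    show "(\<lambda>b. enc (F (dec b))) ` cball 0 A \<subseteq> cball 0 A"
    proof clarify
      fix b :: "int \<Rightarrow>\<^sub>C real" assume b: "b \<in> cball 0 A"
      have "norm (enc (F (dec b))) \<le> A"
      proof (rule norm_bound)
        fix k show "norm (apply_bcontfun (enc (F (dec b))) k) \<le> A"
          using wboundD[OF bd[OF b], of k] w[of k] by (simp add: enc[OF bd[OF b]] divide_le_eq)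
      qed
      then show "enc (F (dec b)) \<in> cball 0 A" by simp
    qed
    show "dist (enc (F (dec b))) (enc (F (dec b'))) \<le> 1 / 2 * dist b b'"
      if b: "b \<in> cball 0 A" "b' \<in> cball 0 A" for b b'
    proof (rule dist_bound)
      fix k
      have "wbound s (dist b b' / 2) (\<lambda>k. F (dec b) k - F (dec b') k)"
        using b by (intro contr dec_wbound dec_diff) simp_all
      from wboundD[OF this, of k]
      show "dist (apply_bcontfun (enc (F (dec b))) k) (apply_bcontfun (enc (F (dec b'))) k) \<le> 1 / 2 * dist b b'"
        using w[of k] by (simp add: enc[OF bd[OF b(1)]] enc[OF bd[OF b(2)]] dist_real_def
            diff_divide_distrib[symmetric] divide_le_eq)
    qed
  qed simp_all
  then obtain b where b: "b \<in> cball 0 A" "enc (F (dec b)) = b" by blast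
  have bd: "wbound s A (dec b)" using b(1) by (intro dec_wbound) simp
  have "dec b k = F (dec b) k" for k
  proof -
    have "dec b k = weight s k * apply_bcontfun (enc (F (dec b))) k" by (simp add: b(2) dec_def)
    also have "\<dots> = F (dec b) k" using w[of k] by (simp add: enc[OF maps[OF bd]])
    finally show ?thesis .
  qed
  then show ?thesis using bd by (intro exI[of _ "dec b"]) auto
qed

text \<open>With the frequency eliminated, \<open>\<kappa> k * cube a 1 * a k\<close> is the contribution of the frequency shift
  to the mode \<open>k\<close>, and \<open>\<eta>\<close> is \<open>\<epsilon>\<^sup>2\<close>. The right-hand side is the single mode plus \<open>\<eta>\<close> times a map
  that is bounded and Lipschitz on the ball of radius \<open>A\<close>, hence a contraction of that ball for
  small \<open>\<eta>\<close>. The map is evaluated at \<open>|k|\<close>, so that its fixed point is even by construction. The constants depend only on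
  \<open>s\<close> and \<open>M\<close>, so they are uniform in the amplitude \<open>p\<close>.\<close>

lemma mode_equation_solution:
  fixes s M :: real
  assumes "0 \<le> s" "0 \<le> M"
  obtains A K \<eta>0 where "0 \<le> A" "0 \<le> K" "0 < \<eta>0"
    "\<forall>p \<eta> \<beta> \<kappa>. \<bar>p\<bar> \<le> 2 \<longrightarrow> 0 < \<eta> \<longrightarrow> \<eta> < \<eta>0 \<longrightarrow>
      (\<forall>k. \<bar>\<beta> k\<bar> \<le> M) \<longrightarrow> (\<forall>k. \<bar>\<kappa> k\<bar> \<le> M) \<longrightarrow>
      (\<forall>k. \<beta> (- k) = \<beta> k) \<longrightarrow> (\<forall>k. \<kappa> (- k) = \<kappa> k) \<longrightarrow>
      (\<exists>a. wbound s A a \<and> (\<forall>k. a (- k) = a k) \<and> a 1 = p / 2 \<and>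
        (\<forall>k. \<bar>k\<bar> \<noteq> 1 \<longrightarrow> a k = \<eta> * (\<beta> k * cube a k - \<kappa> k * cube a 1 * a k)) \<and>
        wbound s (\<eta> * K) (\<lambda>k. a k - single_mode p k))"
proof -
  \<comment> \<open>The single mode has weighted norm at most \<open>1 / weight s 1\<close> when \<open>|p| \<le> 2\<close>; one unit is left for the correction.\<close>
  define A where "A = 1 / weight s 1 + 1"
  define Q where "Q = 48 * inverse_square_sum\<^sup>2 * A\<^sup>2"
  have A: "0 \<le> A" using weight_pos[of s 1] by (simp add: A_def)
  have Q: "0 \<le> Q" by (simp add: Q_def)
  define K where "K = M * (Q * A) + M * (Q * A) * A"
  define L where "L = M * Q + 2 * (M * Q * A)"
  have K: "0 \<le> K" and L: "0 \<le> L" using A Q assms(2) by (simp_all add: K_def L_def)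
  \<comment> \<open>\<open>\<eta> * K \<le> 1\<close> keeps the ball invariant and \<open>\<eta> * L \<le> 1 / 2\<close> gives the contraction.\<close>
  define \<eta>0 where "\<eta>0 = 1 / (2 * (K + L + 1))"
  have \<eta>0: "0 < \<eta>0" using K L by (simp add: \<eta>0_def)
  have sol: "\<exists>a. wbound s A a \<and> (\<forall>k. a (- k) = a k) \<and> a 1 = p / 2 \<and>
        (\<forall>k. \<bar>k\<bar> \<noteq> 1 \<longrightarrow> a k = \<eta> * (\<beta> k * cube a k - \<kappa> k * cube a 1 * a k)) \<and>
        wbound s (\<eta> * K) (\<lambda>k. a k - single_mode p k)"
    if p: "\<bar>p\<bar> \<le> 2" and \<eta>: "0 < \<eta>" "\<eta> < \<eta>0" and \<beta>: "\<And>k. \<bar>\<beta> k\<bar> \<le> M" and \<kappa>: "\<And>k. \<bar>\<kappa> k\<bar> \<le> M"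
      and \<beta>s: "\<And>k. \<beta> (- k) = \<beta> k" and \<kappa>s: "\<And>k. \<kappa> (- k) = \<kappa> k" for p \<eta> \<beta> \<kappa>
  proof -
    define G where "G a k = (if \<bar>k\<bar> = 1 then 0 else \<beta> k * cube a k - \<kappa> k * cube a 1 * a k)"
      for a :: "int \<Rightarrow> real" and k :: int
    define F where "F a k = single_mode p k + \<eta> * G a \<bar>k\<bar>" for a k
    have "\<eta> * (2 * (K + L + 1)) < 1" using \<eta>(2) K L by (simp add: \<eta>0_def field_simps)
    moreover have "0 \<le> \<eta> * K" "0 \<le> \<eta> * L" using \<eta> K L by simp_all
    ultimately have small: "\<eta> * K \<le> 1" "\<eta> * L \<le> 1 / 2" using \<eta>(1) by (simp_all add: algebra_simps)
    have cubeb: "\<bar>cube a k\<bar> \<le> Q * A * weight s k" if a: "wbound s A a" for a k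
    proof -
      have "16 * inverse_square_sum\<^sup>2 * A ^ 3 \<le> Q * A"
        using A by (simp add: Q_def power2_eq_square power3_eq_cube algebra_simps mult_right_mono)
      from wboundD[OF wbound_mono[OF wbound_cube[OF assms(1) a] this]] show ?thesis .
    qed
    have cubeb1: "\<bar>cube a 1\<bar> \<le> Q * A" if a: "wbound s A a" for a
      using cubeb[OF a, of 1] mult_left_mono[OF weight_le_1[OF assms(1), of 1], of "Q * A"] A Q by simp
    have G: "wbound s K (\<lambda>k. G a \<bar>k\<bar>)" if a: "wbound s A a" for a
      unfolding wbound_def
    proof
      fix k :: int
      define l where "l = \<bar>k\<bar>"
      have "\<bar>\<beta> l * cube a l - \<kappa> l * cube a 1 * a l\<bar>
          \<le> \<bar>\<beta> l\<bar> * \<bar>cube a l\<bar> + \<bar>\<kappa> l\<bar> * \<bar>cube a 1\<bar> * \<bar>a l\<bar>"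
        using abs_triangle_ineq4 by (simp add: abs_mult[symmetric])
      also have "\<dots> \<le> M * (Q * A * weight s l) + M * (Q * A) * (A * weight s l)"
        using assms(2) A Q
        by (intro add_mono mult_mono \<beta> \<kappa> cubeb[OF a] cubeb1[OF a] wboundD[OF a]) auto
      also have "\<dots> = K * weight s k" by (simp add: K_def l_def algebra_simps)
      finally show "\<bar>G a \<bar>k\<bar>\<bar> \<le> K * weight s k"
        using K weight_pos[of s k] by (simp add: G_def l_def)
    qed
    have single: "wbound s (1 / weight s 1) (single_mode p)"
      using p weight_pos[of s 1]
      by (intro wbound_mono[OF wbound_single_mode] divide_right_mono) auto
    have \<eta>G: "wbound s (\<eta> * K) (\<lambda>k. \<eta> * G a \<bar>k\<bar>)" if a: "wbound s A a" for a
      using wboundD[OF G[OF a]] \<eta>(1) by (simp add: wbound_def abs_mult mult.assoc)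
    have "\<exists>a. wbound s A a \<and> F a = a"
    proof (rule weighted_contraction[OF A])
      fix a assume a: "wbound s A a"
      show "wbound s A (F a)"
        unfolding F_def A_def
        using wbound_add[OF single wbound_mono[OF \<eta>G[OF a] small(1)]] .
    next
      fix a a' D assume a: "wbound s A a" and a': "wbound s A a'" and D: "wbound s D (\<lambda>k. a k - a' k)"
      note Dn = wbound_nonneg[OF D]
      have cd: "\<bar>cube a k - cube a' k\<bar> \<le> Q * D * weight s k" for k
        using wboundD[OF wbound_cube_diff[OF assms(1) a a' D]] by (simp add: Q_def)
      have cd1: "\<bar>cube a 1 - cube a' 1\<bar> \<le> Q * D"
        using cd[of 1] mult_left_mono[OF weight_le_1[OF assms(1), of 1], of "Q * D"] Dn Q by simp
      show "wbound s (D / 2) (\<lambda>k. F a k - F a' k)"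
        unfolding wbound_def
      proof
        fix k :: int
        define l where "l = \<bar>k\<bar>"
        have "\<bar>(\<beta> l * cube a l - \<kappa> l * cube a 1 * a l) - (\<beta> l * cube a' l - \<kappa> l * cube a' 1 * a' l)\<bar>
            = \<bar>\<beta> l * (cube a l - cube a' l) - (\<kappa> l * (cube a 1 - cube a' 1) * a l
                + \<kappa> l * cube a' 1 * (a l - a' l))\<bar>"
          by (simp add: algebra_simps)
        also have "\<dots> \<le> \<bar>\<beta> l\<bar> * \<bar>cube a l - cube a' l\<bar> + (\<bar>\<kappa> l\<bar> * \<bar>cube a 1 - cube a' 1\<bar> * \<bar>a l\<bar>
                + \<bar>\<kappa> l\<bar> * \<bar>cube a' 1\<bar> * \<bar>a l - a' l\<bar>)"
          unfolding abs_mult[symmetric]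
          by (intro order_trans[OF abs_triangle_ineq4] add_left_mono abs_triangle_ineq)
        also have "\<dots> \<le> M * (Q * D * weight s l) + (M * (Q * D) * (A * weight s l)
                + M * (Q * A) * (D * weight s l))"
          using assms(2) A Q Dn
          by (intro add_mono mult_mono \<beta> \<kappa> cd cd1 cubeb1[OF a'] wboundD[OF a] wboundD[OF D]) auto
        also have "\<dots> = L * D * weight s k" by (simp add: L_def l_def algebra_simps)
        finally have "\<bar>G a l - G a' l\<bar> \<le> L * D * weight s k"
          using L Dn weight_pos[of s k] by (simp add: G_def l_def)
        then have "\<eta> * \<bar>G a l - G a' l\<bar> \<le> \<eta> * (L * D * weight s k)"
          using \<eta>(1) by simp
        also have "\<dots> = (\<eta> * L) * (D * weight s k)" by simp
        also have "\<dots> \<le> 1 / 2 * (D * weight s k)"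
          using small(2) Dn weight_pos[of s k] by (intro mult_right_mono) auto
        finally show "\<bar>F a k - F a' k\<bar> \<le> D / 2 * weight s k"
          using \<eta>(1) by (simp add: F_def l_def right_diff_distrib[symmetric] abs_mult)
      qed
    qed
    then obtain a where a: "wbound s A a" and F: "F a = a" by blast
    have ak: "a k = single_mode p k + \<eta> * G a \<bar>k\<bar>" for k
      using fun_cong[OF F, of k] by (simp add: F_def)
    have even: "a (- k) = a k" for k
      using ak[of k] ak[of "- k"] by (simp add: single_mode_def)
    have abs_arg: "f \<bar>k\<bar> = f k" if "\<And>k. f (- k) = f k" for f :: "int \<Rightarrow> real" and k
      using that[of k] by (simp add: abs_if)
    have "a k = \<eta> * (\<beta> k * cube a k - \<kappa> k * cube a 1 * a k)" if "\<bar>k\<bar> \<noteq> 1" for k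
      using ak[of k] that abs_arg[of a k, OF even] abs_arg[of \<beta> k, OF \<beta>s] abs_arg[of \<kappa> k, OF \<kappa>s]
        abs_arg[of "cube a" k, OF cube_even[of a, OF even]]
      by (simp add: single_mode_def G_def)
    moreover have "a 1 = p / 2" using ak[of 1] by (simp add: single_mode_def G_def)
    moreover have "wbound s (\<eta> * K) (\<lambda>k. a k - single_mode p k)"
    proof -
      have "(\<lambda>k. a k - single_mode p k) = (\<lambda>k. \<eta> * G a \<bar>k\<bar>)" using ak by (auto simp: algebra_simps)
      then show ?thesis using \<eta>G[OF a] by simp
    qed
    ultimately show ?thesis using a even by blast
  qed
  show thesis by (rule that[OF A K \<eta>0]) (intro allI impI sol, auto)
qed

section \<open>Fourier coefficients of trigonometric series\<close>

lemma real_vec_diff: "real_vec (a - b) = real_vec a - real_vec b"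
  by (simp add: real_vec_def vec_eq_iff)

lemma real_vec_nth [simp]: "real_vec m $ j = real_of_int (m $ j)"
  by (simp add: real_vec_def)

text \<open>Cutting the shifted cell at the hyperplane \<open>x $ j = 2 * pi\<close> leaves a slab that a translation by
  one period moves onto the part of the original cell that the shift had uncovered.\<close>

lemma integral_periodic_shift:
  fixes f :: "real ^ 'd::finite \<Rightarrow> complex"
  assumes cont: "continuous_on UNIV f" and per: "\<And>x. f (x + axis j (2 * pi)) = f x"
    and s: "0 \<le> s" "s \<le> 2 * pi"
  shows "integral (cbox 0 (\<chi> j. 2 * pi)) (\<lambda>x. f (x + axis j s)) = integral (cbox 0 (\<chi> j. 2 * pi)) f"
proof -
  define P :: "real ^ 'd" where "P = (\<chi> j. 2 * pi)"
  have int: "f integrable_on cbox a b" for a b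
    by (intro integrable_continuous continuous_on_subset[OF cont]) auto
  have shift: "integral (cbox (a + c) (b + c)) f = integral (cbox a b) (\<lambda>x. f (x + c))" for a b c
    using integral_shift_cbox_plus[of a b f c] by (simp add: o_def add.commute)
  have basis: "axis j (1::real) \<in> Basis" by (simp add: axis_in_Basis_iff)
  have axis_nth: "axis j t $ i = (if i = j then t else 0)" for t :: real and i
    by (simp add: axis_def)
  have box: "x \<in> cbox a b \<longleftrightarrow> (a $ j \<le> x $ j \<and> x $ j \<le> b $ j) \<and>
      (\<forall>i. i \<noteq> j \<longrightarrow> a $ i \<le> x $ i \<and> x $ i \<le> b $ i)" for x a b :: "real ^ 'd"
    by (metis mem_box_cart)
  have upper: "cbox (axis j s) (P + axis j s) \<inter> {x. x \<bullet> axis j 1 \<le> 2 * pi} = cbox (axis j s) P"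
    using s by (auto simp: box P_def axis_nth inner_axis)
  have overlap: "cbox (axis j s) (P + axis j s) \<inter> {x. x \<bullet> axis j 1 \<ge> 2 * pi} =
      cbox (0 + axis j (2 * pi)) ((P - axis j (2 * pi - s)) + axis j (2 * pi))"
    using s by (auto simp: box P_def axis_nth inner_axis)
  have low: "cbox 0 P \<inter> {x. x \<bullet> axis j 1 \<le> s} = cbox 0 (P - axis j (2 * pi - s))"
    using s by (auto simp: box P_def axis_nth inner_axis)
  have high: "cbox 0 P \<inter> {x. x \<bullet> axis j 1 \<ge> s} = cbox (axis j s) P"
    using s by (auto simp: box P_def axis_nth inner_axis)
  have "integral (cbox 0 P) (\<lambda>x. f (x + axis j s)) = integral (cbox (axis j s) (P + axis j s)) f"
    using shift[where a = 0 and b = P and c = "axis j s"] by simp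
  also have "\<dots> = integral (cbox (axis j s) P) f +
      integral (cbox (0 + axis j (2 * pi)) ((P - axis j (2 * pi - s)) + axis j (2 * pi))) f"
    using integral_split[OF int[of "axis j s" "P + axis j s"] basis, of "2 * pi"] by (simp only: upper overlap)
  also have "integral (cbox (0 + axis j (2 * pi)) ((P - axis j (2 * pi - s)) + axis j (2 * pi))) f =
      integral (cbox 0 (P - axis j (2 * pi - s))) (\<lambda>x. f (x + axis j (2 * pi)))"
    by (rule shift)
  also have "\<dots> = integral (cbox 0 (P - axis j (2 * pi - s))) f" by (simp add: per)
  also have "integral (cbox (axis j s) P) f + \<dots> = integral (cbox 0 P) f"
    using integral_split[OF int[of 0 P] basis, of s] by (simp only: low high add.commute)
  finally show ?thesis by (simp add: P_def)
qed

lemma exp_ii_periodic: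
  fixes m :: "int ^ 'd::finite"
  shows "exp (\<i> * complex_of_real (real_vec m \<bullet> (x + axis j (2 * pi)))) =
    exp (\<i> * complex_of_real (real_vec m \<bullet> x))"
proof -
  have "real_vec m \<bullet> (x + axis j (2 * pi)) = real_vec m \<bullet> x + 2 * pi * real_of_int (m $ j)"
    by (simp add: inner_add_right inner_axis)
  then show ?thesis
    unfolding cis_conv_exp[symmetric] by (simp add: cis_mult[symmetric] cis_multiple_2pi)
qed

text \<open>If \<open>m $ j \<noteq> 0\<close>, a shift by \<open>pi / |m $ j|\<close> along the axis \<open>j\<close> changes the sign of the character
  but, by periodicity, not its integral.\<close>

lemma integral_character:
  fixes m :: "int ^ 'd::finite"
  shows "integral (cbox 0 (\<chi> j. 2 * pi)) (\<lambda>x. exp (\<i> * complex_of_real (real_vec m \<bullet> x))) =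
    (if m = 0 then complex_of_real ((2 * pi) ^ CARD('d)) else 0)"
proof (cases "m = 0")
  case True
  then have "(\<lambda>x. exp (\<i> * complex_of_real (real_vec m \<bullet> x))) = (\<lambda>x. 1)"
    by (simp add: real_vec_def zero_vec_def[symmetric] fun_eq_iff inner_vec_def)
  moreover have "measure lborel (cbox (0 :: real ^ 'd) (\<chi> j. 2 * pi)) = (2 * pi) ^ CARD('d)"
    by (subst content_cbox_cart) (auto simp: interval_eq_empty_cart)
  ultimately show ?thesis using True by (simp add: scaleR_conv_of_real)
next
  case False
  then obtain j where j: "m $ j \<noteq> 0" by (auto simp: vec_eq_iff)
  define f where "f x = exp (\<i> * complex_of_real (real_vec m \<bullet> x))" for x :: "real ^ 'd"
  define s where "s = pi / \<bar>real_of_int (m $ j)\<bar>"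
  have "1 \<le> \<bar>real_of_int (m $ j)\<bar>" using j by linarith
  then have s: "0 \<le> s" "s \<le> 2 * pi" by (simp_all add: s_def divide_le_eq)
  have "f (x + axis j s) = - f x" for x
  proof -
    have "real_vec m \<bullet> (x + axis j s) = real_vec m \<bullet> x + (if m $ j > 0 then pi else - pi)"
      using j by (simp add: inner_add_right inner_axis s_def abs_if)
    then show ?thesis unfolding f_def cis_conv_exp[symmetric] by (simp add: complex_eq_iff)
  qed
  then have "integral (cbox 0 (\<chi> j. 2 * pi)) (\<lambda>x. f (x + axis j s)) = - integral (cbox 0 (\<chi> j. 2 * pi)) f"
    by simp
  moreover have "integral (cbox 0 (\<chi> j. 2 * pi)) (\<lambda>x. f (x + axis j s)) = integral (cbox 0 (\<chi> j. 2 * pi)) f"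
    by (intro integral_periodic_shift s) (auto simp: f_def exp_ii_periodic intro!: continuous_intros)
  ultimately show ?thesis using False by (simp add: f_def[abs_def])
qed

text \<open>Uniform convergence (Weierstrass test) permits integration term by term. The frequencies are given
  as a family \<open>l\<close> because the series met below run over the multiples of one lattice vector.\<close>

lemma fourier_coeff_trig_series:
  fixes l :: "'i \<Rightarrow> int ^ 'd::finite" and c :: "'i \<Rightarrow> complex"
  assumes c: "(\<lambda>i. norm (c i)) summable_on UNIV"
  shows "fourier_coeff (\<lambda>x. \<Sum>\<^sub>\<infinity>i. c i * exp (\<i> * complex_of_real (real_vec (l i) \<bullet> x))) m =
    (\<Sum>\<^sub>\<infinity>i. if l i = m then c i else 0)"
proof -
  define B :: "(real ^ 'd) set" where "B = cbox 0 (\<chi> j. 2 * pi)"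
  define e where "e i x = c i * exp (\<i> * complex_of_real (real_vec (l i - m) \<bullet> x))" for i and x :: "real ^ 'd"
  define V where "V = complex_of_real ((2 * pi) ^ CARD('d))"
  have V: "V \<noteq> 0" by (simp add: V_def)
  have "uniform_limit B (\<lambda>F x. \<Sum>i\<in>F. e i x) (\<lambda>x. \<Sum>\<^sub>\<infinity>i. e i x) (finite_subsets_at_top UNIV)"
    by (rule Weierstrass_m_test_general[OF _ c]) (simp add: e_def norm_mult)
  then obtain I J where I: "\<And>F. ((\<lambda>x. \<Sum>i\<in>F. e i x) has_integral I F) B"
    and J: "((\<lambda>x. \<Sum>\<^sub>\<infinity>i. e i x) has_integral J) B" and IJ: "(I \<longlongrightarrow> J) (finite_subsets_at_top UNIV)"
    unfolding B_def
    by (rule uniform_limit_integral_cbox) (auto simp: e_def intro!: continuous_intros)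
  have ei: "(e i has_integral (if l i = m then c i else 0) * V) B" for i
  proof -
    have "e i integrable_on B" unfolding B_def e_def by (intro integrable_continuous continuous_intros)
    moreover have "integral B (e i) = (if l i = m then c i else 0) * V"
      unfolding e_def B_def V_def by (simp add: integral_character)
    ultimately show ?thesis by (simp add: has_integral_iff)
  qed
  have "\<forall>\<^sub>F F in finite_subsets_at_top UNIV. I F = (\<Sum>i\<in>F. (if l i = m then c i else 0) * V)"
    by (intro eventually_finite_subsets_at_top_weakI has_integral_unique[OF I] has_integral_sum ei)
  from Lim_transform_eventually[OF IJ this]
  have "((\<lambda>i. (if l i = m then c i else 0) * V) has_sum J) UNIV"
    unfolding has_sum_def .
  then have JV: "J = (\<Sum>\<^sub>\<infinity>i. if l i = m then c i else 0) * V"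
    by (metis infsumI infsum_cmult_left')
  have "e i x = c i * exp (\<i> * complex_of_real (real_vec (l i) \<bullet> x)) *
      exp (- \<i> * complex_of_real (real_vec m \<bullet> x))" for i x
    by (simp add: e_def real_vec_diff inner_diff_left right_diff_distrib exp_diff exp_minus divide_inverse)
  then have "(\<Sum>\<^sub>\<infinity>i. c i * exp (\<i> * complex_of_real (real_vec (l i) \<bullet> x))) *
      exp (- \<i> * complex_of_real (real_vec m \<bullet> x)) = (\<Sum>\<^sub>\<infinity>i. e i x)" for x
    by (simp only: infsum_cmult_left')
  then have "fourier_coeff (\<lambda>x. \<Sum>\<^sub>\<infinity>i. c i * exp (\<i> * complex_of_real (real_vec (l i) \<bullet> x))) m = (1 / V) * J"
    unfolding fourier_coeff_def using J by (simp add: B_def[symmetric] integral_unique V_def)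
  then show ?thesis using V by (simp add: JV)
qed

lemma frac_deriv_trig_series:
  fixes l :: "'i \<Rightarrow> int ^ 'd::finite" and c :: "'i \<Rightarrow> complex"
  assumes "inj l" and c: "(\<lambda>i. norm (c i)) summable_on UNIV"
  shows "frac_deriv \<alpha> (\<lambda>x. \<Sum>\<^sub>\<infinity>i. c i * exp (\<i> * complex_of_real (real_vec (l i) \<bullet> x))) x =
    (\<Sum>\<^sub>\<infinity>i. complex_of_real (bracket (l i) powr \<alpha>) * c i * exp (\<i> * complex_of_real (real_vec (l i) \<bullet> x)))"
proof -
  have coeff: "(\<Sum>\<^sub>\<infinity>i. if l i = l k then c i else 0) = c k" for k
  proof -
    have "(\<Sum>\<^sub>\<infinity>i. if l i = l k then c i else 0) = (\<Sum>\<^sub>\<infinity>i\<in>{k}. c i)"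
      using assms(1) by (intro infsum_cong_neutral) (auto simp: inj_eq)
    then show ?thesis by simp
  qed
  have off: "(\<Sum>\<^sub>\<infinity>i. if l i = m then c i else 0) = 0" if "m \<notin> range l" for m
    using that by (intro infsum_0) auto
  show ?thesis
    unfolding frac_deriv_def fourier_coeff_trig_series[OF c]
    by (subst infsum_cong_neutral[where T = "range l" and g = "\<lambda>m. complex_of_real (bracket m powr \<alpha>) *
        (\<Sum>\<^sub>\<infinity>i. if l i = m then c i else 0) * exp (\<i> * complex_of_real (real_vec m \<bullet> x))"])
      (auto simp: off infsum_reindex[OF assms(1)] o_def coeff)
qed

section \<open>Travelling waves as classical solutions\<close>

lemma infsum_int_eq_suminf:
  fixes f :: "int \<Rightarrow> real"
  assumes "(\<lambda>k. \<bar>f k\<bar>) summable_on UNIV"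
  shows "summable (\<lambda>n. \<bar>f (int_decode n)\<bar>)" "(\<Sum>\<^sub>\<infinity>k. f k) = (\<Sum>n. f (int_decode n))"
proof -
  have *: "(\<lambda>n. \<bar>f (int_decode n)\<bar>) summable_on UNIV"
    using summable_on_reindex_bij_betw[OF bij_int_decode, of "\<lambda>k. \<bar>f k\<bar>"] assms by simp
  show sm: "summable (\<lambda>n. \<bar>f (int_decode n)\<bar>)"
    by (rule summable_on_imp_summable[OF *])
  have "((\<lambda>n. f (int_decode n)) has_sum (\<Sum>n. f (int_decode n))) UNIV"
    using sm summable_rabs_cancel[OF sm] by (intro norm_summable_imp_has_sum) (auto simp: summable_sums)
  then show "(\<Sum>\<^sub>\<infinity>k. f k) = (\<Sum>n. f (int_decode n))"
    using infsum_reindex_bij_betw[OF bij_int_decode, of f] by (simp add: infsumI)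
qed

text \<open>Term-by-term differentiation for series over the integers, reduced to ordinary series through
  the enumeration \<^const>\<open>int_decode\<close>.\<close>

lemma has_real_derivative_infsum:
  fixes f f' :: "int \<Rightarrow> real \<Rightarrow> real"
  assumes der: "\<And>k x. (f k has_real_derivative f' k x) (at x)"
    and bnd: "\<And>k x. \<bar>f k x\<bar> \<le> M k" "\<And>k x. \<bar>f' k x\<bar> \<le> M' k"
    and sums: "M summable_on UNIV" "M' summable_on UNIV"
  shows "((\<lambda>x. \<Sum>\<^sub>\<infinity>k. f k x) has_real_derivative (\<Sum>\<^sub>\<infinity>k. f' k x)) (at x)"
proof -
  have nonneg: "0 \<le> M k" "0 \<le> M' k" for k
    using bnd(1)[of k 0] bnd(2)[of k 0] by linarith+
  have sf: "(\<lambda>k. \<bar>f k x\<bar>) summable_on UNIV" "(\<lambda>k. \<bar>f' k x\<bar>) summable_on UNIV" for x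
    using sums bnd by (auto intro: summable_on_comparison_test)
  have sM: "summable (\<lambda>n. M' (int_decode n))"
    using infsum_int_eq_suminf(1)[of M'] sums(2) nonneg by simp
  have uc: "uniformly_convergent_on UNIV (\<lambda>n x. \<Sum>i<n. f' (int_decode i) x)"
    by (rule Weierstrass_m_test'[OF _ sM]) (simp add: bnd)
  have "summable (\<lambda>n. f (int_decode n) 0)"
    using infsum_int_eq_suminf(1)[OF sf(1), of 0] by (rule summable_rabs_cancel)
  then have "((\<lambda>x. \<Sum>n. f (int_decode n) x) has_real_derivative (\<Sum>n. f' (int_decode n) x)) (at x)"
    using der by (intro has_field_derivative_series'(2)[OF convex_UNIV _ uc, of _ 0]) auto
  then show ?thesis
    by (simp add: infsum_int_eq_suminf(2)[OF sf(1)] infsum_int_eq_suminf(2)[OF sf(2)])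
qed

text \<open>The factor \<open>exp (- s * |k|)\<close> absorbs any power of \<open>k\<close> because \<open>x ^ n / fact n \<le> exp x\<close>.\<close>

lemma wbound_moment_summable:
  assumes "0 < s" "wbound s A a"
  shows "(\<lambda>k. \<bar>a k\<bar> * \<bar>real_of_int k\<bar> ^ n) summable_on UNIV"
proof (rule summable_on_comparison_test)
  show "(\<lambda>k::int. A * (fact n / s ^ n) * (1 / (1 + (real_of_int k)\<^sup>2))) summable_on UNIV"
    by (intro summable_on_cmult_right summable_inverse_square_int)
  fix k :: int
  have "(s * \<bar>real_of_int k\<bar>) ^ n / fact n \<le> exp (s * \<bar>real_of_int k\<bar>)"
    using sum_le_suminf[OF summable_exp_generic[of "s * \<bar>real_of_int k\<bar>"], of "{n}"] assms(1)
    by (simp add: exp_def divide_inverse mult.commute)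
  then have "\<bar>real_of_int k\<bar> ^ n * exp (- s * \<bar>real_of_int k\<bar>) \<le> fact n / s ^ n"
    using assms(1) by (simp add: exp_minus field_simps power_mult_distrib)
  from divide_right_mono[OF this, of "1 + (real_of_int k)\<^sup>2"]
  have "\<bar>real_of_int k\<bar> ^ n * weight s k \<le> fact n / s ^ n * (1 / (1 + (real_of_int k)\<^sup>2))"
    by (simp add: weight_def)
  then have "A * (\<bar>real_of_int k\<bar> ^ n * weight s k) \<le> A * (fact n / s ^ n * (1 / (1 + (real_of_int k)\<^sup>2)))"
    using wbound_nonneg[OF assms(2)] by (rule mult_left_mono)
  moreover have "\<bar>a k\<bar> * \<bar>real_of_int k\<bar> ^ n \<le> A * weight s k * \<bar>real_of_int k\<bar> ^ n"
    by (intro mult_right_mono wboundD[OF assms(2)]) auto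
  ultimately show "\<bar>a k\<bar> * \<bar>real_of_int k\<bar> ^ n \<le> A * (fact n / s ^ n) * (1 / (1 + (real_of_int k)\<^sup>2))"
    by (simp add: mult_ac)
qed auto

text \<open>The \<open>n\<close>-th derivative of \<open>\<Sum>k. a k * cos (k * \<theta>)\<close>: each derivative advances the phase by
  \<open>pi / 2\<close> and contributes a factor \<open>k\<close>. This form covers all orders in one formula.\<close>

definition profile :: "(int \<Rightarrow> real) \<Rightarrow> nat \<Rightarrow> real \<Rightarrow> real" where
  "profile a n \<theta> = (\<Sum>\<^sub>\<infinity>k. a k * real_of_int k ^ n * cos (real_of_int k * \<theta> + real n * (pi / 2)))"

lemma profile_has_derivative:
  assumes "0 < s" "wbound s A a"
  shows "(profile a n has_real_derivative profile a (Suc n) \<theta>) (at \<theta>)"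
  unfolding profile_def[abs_def]
proof (rule has_real_derivative_infsum)
  fix k :: int and x :: real
  have "cos (real_of_int k * x + real (Suc n) * (pi / 2)) = - sin (real_of_int k * x + real n * (pi / 2))"
    by (simp add: minus_sin_cos_eq add_divide_distrib distrib_right add_ac)
  then show "((\<lambda>\<theta>. a k * real_of_int k ^ n * cos (real_of_int k * \<theta> + real n * (pi / 2)))
      has_real_derivative a k * real_of_int k ^ Suc n * cos (real_of_int k * x + real (Suc n) * (pi / 2))) (at x)"
    by (auto intro!: derivative_eq_intros)
  show "\<bar>a k * real_of_int k ^ n * cos (real_of_int k * x + real n * (pi / 2))\<bar> \<le> \<bar>a k\<bar> * \<bar>real_of_int k\<bar> ^ n"
    unfolding abs_mult power_abs by (rule mult_left_le) auto
  show "\<bar>a k * real_of_int k ^ Suc n * cos (real_of_int k * x + real (Suc n) * (pi / 2))\<bar>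
      \<le> \<bar>a k\<bar> * \<bar>real_of_int k\<bar> ^ Suc n"
    unfolding abs_mult power_abs by (rule mult_left_le) auto
qed (rule wbound_moment_summable[OF assms])+

lemma profile_0: "profile a 0 \<theta> = (\<Sum>\<^sub>\<infinity>k. a k * cos (real_of_int k * \<theta>))"
  by (simp add: profile_def)

lemma profile_2: "profile a 2 \<theta> = (\<Sum>\<^sub>\<infinity>k. - (a k * (real_of_int k)\<^sup>2 * cos (real_of_int k * \<theta>)))"
  by (simp add: profile_def)

lemma profile_periodic: "profile a 0 (\<theta> + 2 * pi * real_of_int n) = profile a 0 \<theta>"
proof -
  have "cos (real_of_int k * (\<theta> + 2 * pi * real_of_int n)) = cos (real_of_int k * \<theta>)" for k
  proof -
    have "real_of_int k * (\<theta> + 2 * pi * real_of_int n) = real_of_int k * \<theta> + 2 * pi * real_of_int (k * n)"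
      by (simp add: algebra_simps)
    then show ?thesis
      unfolding cos_add by (simp only: cos_int_2pin sin_int_2pin cos_add mult_1_right mult_zero_right diff_0_right)
  qed
  then show ?thesis by (simp add: profile_0)
qed

text \<open>The series equals its reflection \<open>k \<mapsto> - k\<close>; averaging the two leaves the cosines.\<close>

lemma even_cis_series:
  fixes c :: "int \<Rightarrow> real"
  assumes "\<And>k. c (- k) = c k" "(\<lambda>k. \<bar>c k\<bar>) summable_on UNIV"
  shows "(\<Sum>\<^sub>\<infinity>k. complex_of_real (c k) * cis (real_of_int k * \<theta>)) =
    complex_of_real (\<Sum>\<^sub>\<infinity>k. c k * cos (real_of_int k * \<theta>))"
proof -
  let ?f = "\<lambda>k. complex_of_real (c k) * cis (real_of_int k * \<theta>)"
  let ?g = "\<lambda>k. complex_of_real (c k) * cis (- (real_of_int k * \<theta>))"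
  have sm: "?f summable_on UNIV" "?g summable_on UNIV"
    by (rule abs_summable_summable, simp add: norm_mult assms(2))+
  have sc: "(\<lambda>k. c k * cos (real_of_int k * \<theta>)) summable_on UNIV"
  proof (rule abs_summable_summable)
    show "(\<lambda>k. norm (c k * cos (real_of_int k * \<theta>))) summable_on UNIV"
      by (rule summable_on_comparison_test[OF assms(2)]) (auto simp: abs_mult intro: mult_left_le)
  qed
  have "(\<Sum>\<^sub>\<infinity>k. ?f k) = (\<Sum>\<^sub>\<infinity>k. ?g k)"
    using assms(1) by (intro infsum_reindex_bij_witness[of _ uminus uminus]) auto
  then have "2 * (\<Sum>\<^sub>\<infinity>k. ?f k) = (\<Sum>\<^sub>\<infinity>k. ?f k + ?g k)"
    using infsum_add[OF sm] by simp
  also have "\<dots> = (\<Sum>\<^sub>\<infinity>k. 2 * complex_of_real (c k * cos (real_of_int k * \<theta>)))"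
    by (intro infsum_cong) (simp add: complex_eq_iff)
  also have "\<dots> = 2 * complex_of_real (\<Sum>\<^sub>\<infinity>k. c k * cos (real_of_int k * \<theta>))"
    unfolding infsum_cmult_right' by (simp only: infsum_of_real_complex[OF sc])
  finally show ?thesis by simp
qed

text \<open>The functions \<open>U n\<close> are to be thought of as the successive derivatives of \<open>U 0\<close>.\<close>

lemma has_derivative_plane:
  fixes L :: "'a::euclidean_space \<Rightarrow> real"
  assumes "\<And>n \<theta>. (U n has_real_derivative U (Suc n) \<theta>) (at \<theta>)" "bounded_linear L"
  shows "((\<lambda>z. c * U n (L z)) has_derivative (\<lambda>v. c * L v * U (Suc n) (L z))) (at z)"
proof -
  have "(U n has_derivative (\<lambda>h. h * U (Suc n) (L z))) (at (L z))"
    using assms(1)[of n "L z"] by (simp add: has_field_derivative_def mult_commute_abs)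
  from has_derivative_compose[OF bounded_linear_imp_has_derivative[OF assms(2)] this]
  have "((\<lambda>z. U n (L z)) has_derivative (\<lambda>v. L v * U (Suc n) (L z))) (at z)" .
  from has_derivative_mult_right[OF this, of c] show ?thesis by (simp add: mult.assoc)
qed

lemma dir_deriv_plane:
  fixes L :: "'a::euclidean_space \<Rightarrow> real"
  assumes "\<And>n \<theta>. (U n has_real_derivative U (Suc n) \<theta>) (at \<theta>)" "bounded_linear L"
  shows "dir_deriv v (\<lambda>z. c * U n (L z)) = (\<lambda>z. (c * L v) * U (Suc n) (L z))"
proof
  fix z
  show "dir_deriv v (\<lambda>z. c * U n (L z)) z = (c * L v) * U (Suc n) (L z)"
    unfolding dir_deriv_def frechet_derivative_at[OF has_derivative_plane[of U, OF assms], symmetric] ..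
qed

text \<open>Directional derivatives map the family \<open>c * U n (L z)\<close> into itself, so the induction runs over
  all \<open>c\<close> and \<open>n\<close> at once.\<close>

lemma smooth_plane:
  fixes L :: "'a::euclidean_space \<Rightarrow> real"
  assumes "\<And>n \<theta>. (U n has_real_derivative U (Suc n) \<theta>) (at \<theta>)" "bounded_linear L"
  shows "smooth (\<lambda>z. U n (L z))"
proof -
  have diff: "(\<lambda>z. c * U n (L z)) differentiable at z" for c n z
    using has_derivative_plane[of U, OF assms] by (rule differentiableI)
  have "C_k k (\<lambda>z. c * U n (L z))" for k c n
  proof (induction k arbitrary: c n)
    case 0
    show ?case
      using diff[of c n]
      by (simp add: continuous_on_eq_continuous_at differentiable_imp_continuous_within)
  next
    case (Suc k)
    then show ?case unfolding C_k.simps dir_deriv_plane[of U, OF assms] using diff by blast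
  qed
  from this[of _ 1 n] show ?thesis by (simp add: smooth_def)
qed

lemma real_vec_scale: "real_vec (k *s m) = real_of_int k *\<^sub>R real_vec m"
  by (simp add: real_vec_def vec_eq_iff)

lemma norm_real_vec_square: "(norm (real_vec m))\<^sup>2 = (\<Sum>j\<in>UNIV. (real_of_int (m $ j))\<^sup>2)"
  unfolding power2_norm_eq_inner by (simp add: inner_vec_def power2_eq_square)

lemma inj_multiples:
  fixes m0 :: "int ^ 'd::finite"
  assumes "m0 \<noteq> 0"
  shows "inj (\<lambda>k::int. k *s m0)"
proof (rule injI)
  fix k k' :: int assume "k *s m0 = k' *s m0"
  moreover obtain j where "m0 $ j \<noteq> 0" using assms by (auto simp: vec_eq_iff)
  ultimately show "k = k'" by (auto simp: vec_eq_iff)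
qed

definition travelling_wave :: "int ^ 'd::finite \<Rightarrow> real \<Rightarrow> (int \<Rightarrow> real) \<Rightarrow> (real ^ 'd) \<times> real \<Rightarrow> real" where
  "travelling_wave m0 \<omega> a = (\<lambda>(x, t). profile a 0 (real_vec m0 \<bullet> x + \<omega> * t))"

text \<open>Along the phase, \<open>\<partial>\<^sub>t\<^sub>t\<close> and \<open>\<Delta>\<close> act as \<open>\<omega>\<^sup>2\<close> and \<open>|m0|\<^sup>2\<close> times the second derivative of the
  profile. The cube of the profile has coefficients \<open>cube a\<close>, and \<^const>\<open>frac_deriv\<close> multiplies the
  \<open>k\<close>-th one by \<open>\<langle>k m0\<rangle>\<^sup>\<alpha>\<close>. The mode equations then cancel term by term.\<close>

lemma travelling_wave_solves:
  fixes m0 :: "int ^ 'd::finite"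
  assumes "m0 \<noteq> 0" "0 < s" "wbound s A a" and even: "\<And>k. a (- k) = a k"
    and eq: "\<And>k. ((real_of_int k)\<^sup>2 * ((norm (real_vec m0))\<^sup>2 - \<omega>\<^sup>2) + \<rho>) * a k +
      \<epsilon>\<^sup>2 * (bracket (k *s m0) powr \<alpha> * cube a k) = 0"
  shows "solves_nlw \<alpha> \<rho> \<epsilon> (travelling_wave m0 \<omega> a)"
proof -
  define L :: "(real ^ 'd) \<times> real \<Rightarrow> real" where "L = (\<lambda>z. real_vec m0 \<bullet> fst z + \<omega> * snd z)"
  have L: "bounded_linear L"
    unfolding L_def
    by (intro bounded_linear_add bounded_linear_compose[OF bounded_linear_inner_right bounded_linear_fst]
        bounded_linear_compose[OF bounded_linear_mult_right bounded_linear_snd])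
  note U = profile_has_derivative[OF assms(2,3)]
  have y: "travelling_wave m0 \<omega> a = (\<lambda>z. profile a 0 (L z))"
    by (auto simp: travelling_wave_def L_def)
  have second: "dir_deriv v (dir_deriv v (\<lambda>z. profile a 0 (L z))) = (\<lambda>z. (L v)\<^sup>2 * profile a 2 (L z))" for v
    using dir_deriv_plane[of "profile a", OF U L, of v 1 0]
      dir_deriv_plane[of "profile a", OF U L, of v "L v" 1]
    by (simp add: power2_eq_square numeral_2_eq_2)
  have tt: "d_tt (travelling_wave m0 \<omega> a) z = \<omega>\<^sup>2 * profile a 2 (L z)" for z
    by (simp add: d_tt_def y second) (simp add: L_def)
  have lap: "laplacian_x (travelling_wave m0 \<omega> a) z = (norm (real_vec m0))\<^sup>2 * profile a 2 (L z)" for z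
  proof -
    have "L (axis j 1, 0) = real_of_int (m0 $ j)" for j by (simp add: L_def inner_axis)
    then show ?thesis by (simp add: laplacian_x_def y second norm_real_vec_square sum_distrib_right)
  qed
  have sum0: "(\<lambda>k. \<bar>a k\<bar>) summable_on UNIV"
    using assms(2,3) by (intro wbound_summable) auto
  have sum2: "(\<lambda>k. \<bar>a k\<bar> * (real_of_int k)\<^sup>2) summable_on UNIV"
    using wbound_moment_summable[OF assms(2,3), of 2] by simp
  define c where "c k = ((real_of_int k)\<^sup>2 * ((norm (real_vec m0))\<^sup>2 - \<omega>\<^sup>2) + \<rho>) * a k" for k
  have c_even: "c (- k) = c k" for k by (simp add: c_def even)
  have c_sum: "(\<lambda>k. \<bar>c k\<bar>) summable_on UNIV"
  proof (rule summable_on_comparison_test)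
    show "(\<lambda>k. \<bar>(norm (real_vec m0))\<^sup>2 - \<omega>\<^sup>2\<bar> * (\<bar>a k\<bar> * (real_of_int k)\<^sup>2) + \<bar>\<rho>\<bar> * \<bar>a k\<bar>) summable_on UNIV"
      by (intro summable_on_add summable_on_cmult_right sum0 sum2)
    show "\<bar>c k\<bar> \<le> \<bar>(norm (real_vec m0))\<^sup>2 - \<omega>\<^sup>2\<bar> * (\<bar>a k\<bar> * (real_of_int k)\<^sup>2) + \<bar>\<rho>\<bar> * \<bar>a k\<bar>" for k
    proof -
      have "c k = ((norm (real_vec m0))\<^sup>2 - \<omega>\<^sup>2) * (a k * (real_of_int k)\<^sup>2) + \<rho> * a k"
        by (simp add: c_def algebra_simps)
      then show ?thesis
        using abs_triangle_ineq[of "((norm (real_vec m0))\<^sup>2 - \<omega>\<^sup>2) * (a k * (real_of_int k)\<^sup>2)" "\<rho> * a k"]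
        by (simp add: abs_mult)
    qed
  qed auto
  have sum_cos: "(\<lambda>k. f k * cos (real_of_int k * \<theta>)) summable_on UNIV"
    if "(\<lambda>k. \<bar>f k\<bar>) summable_on UNIV" for f :: "int \<Rightarrow> real" and \<theta>
  proof (rule abs_summable_summable)
    show "(\<lambda>k. norm (f k * cos (real_of_int k * \<theta>))) summable_on UNIV"
      by (rule summable_on_comparison_test[OF that]) (auto simp: abs_mult intro: mult_left_le)
  qed
  have linear: "\<omega>\<^sup>2 * profile a 2 \<theta> - (norm (real_vec m0))\<^sup>2 * profile a 2 \<theta> + \<rho> * profile a 0 \<theta> =
      (\<Sum>\<^sub>\<infinity>k. c k * cos (real_of_int k * \<theta>))" for \<theta>
  proof -
    have "\<omega>\<^sup>2 * profile a 2 \<theta> - (norm (real_vec m0))\<^sup>2 * profile a 2 \<theta> + \<rho> * profile a 0 \<theta> =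
      ((norm (real_vec m0))\<^sup>2 - \<omega>\<^sup>2) * (\<Sum>\<^sub>\<infinity>k. a k * (real_of_int k)\<^sup>2 * cos (real_of_int k * \<theta>)) +
      \<rho> * (\<Sum>\<^sub>\<infinity>k. a k * cos (real_of_int k * \<theta>))"
      by (simp add: profile_0 profile_2 infsum_uminus algebra_simps)
    also have "\<dots> = (\<Sum>\<^sub>\<infinity>k. ((norm (real_vec m0))\<^sup>2 - \<omega>\<^sup>2) * (a k * (real_of_int k)\<^sup>2 * cos (real_of_int k * \<theta>)) +
      \<rho> * (a k * cos (real_of_int k * \<theta>)))"
      unfolding infsum_cmult_right'[symmetric] using sum2
      by (intro infsum_add[symmetric] summable_on_cmult_right sum_cos sum0) (simp add: abs_mult)
    also have "\<dots> = (\<Sum>\<^sub>\<infinity>k. c k * cos (real_of_int k * \<theta>))"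
      by (intro infsum_cong) (simp add: c_def algebra_simps)
    finally show ?thesis .
  qed
  have cube_abs: "(\<lambda>k. \<bar>cube a k\<bar>) summable_on UNIV"
    using wbound_summable[OF _ wbound_cube[OF _ assms(3)]] assms(2) by simp
  have frac: "complex_of_real (\<epsilon>\<^sup>2) *
      frac_deriv \<alpha> (\<lambda>x'. complex_of_real (travelling_wave m0 \<omega> a (x', t) ^ 3)) x =
      - complex_of_real (\<Sum>\<^sub>\<infinity>k. c k * cos (real_of_int k * (real_vec m0 \<bullet> x + \<omega> * t)))" for x t
  proof -
    define q where "q k = complex_of_real (cube a k) * cis (real_of_int k * (\<omega> * t))" for k
    have phase: "cis (real_of_int k * (\<omega> * t)) * exp (\<i> * complex_of_real (real_vec (k *s m0) \<bullet> x'))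
        = cis (real_of_int k * (real_vec m0 \<bullet> x' + \<omega> * t))" for k x'
      by (simp add: real_vec_scale cis_conv_exp[symmetric] cis_mult algebra_simps del: of_real_mult)
    have "complex_of_real (travelling_wave m0 \<omega> a (x', t) ^ 3) =
        (\<Sum>\<^sub>\<infinity>k. q k * exp (\<i> * complex_of_real (real_vec (k *s m0) \<bullet> x')))" for x'
    proof -
      have "complex_of_real (travelling_wave m0 \<omega> a (x', t) ^ 3) =
         (\<Sum>\<^sub>\<infinity>k. complex_of_real (a k) * cis (real_of_int k * (real_vec m0 \<bullet> x' + \<omega> * t))) ^ 3"
        using even_cis_series[OF even sum0] by (simp add: travelling_wave_def profile_0)
      also have "\<dots> = (\<Sum>\<^sub>\<infinity>k. complex_of_real (cube a k) * cis (real_of_int k * (real_vec m0 \<bullet> x' + \<omega> * t)))"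
        using assms(2) by (intro cube_cis[OF _ assms(3)]) auto
      finally show ?thesis by (simp add: q_def mult.assoc phase)
    qed
    then have "complex_of_real (\<epsilon>\<^sup>2) *
      frac_deriv \<alpha> (\<lambda>x'. complex_of_real (travelling_wave m0 \<omega> a (x', t) ^ 3)) x =
      complex_of_real (\<epsilon>\<^sup>2) * (\<Sum>\<^sub>\<infinity>k. complex_of_real (bracket (k *s m0) powr \<alpha>) * q k *
        exp (\<i> * complex_of_real (real_vec (k *s m0) \<bullet> x)))"
      using frac_deriv_trig_series[OF inj_multiples[OF assms(1)], of q \<alpha> x] cube_abs by (simp add: q_def norm_mult)
    also have "\<dots> = (\<Sum>\<^sub>\<infinity>k. - (complex_of_real (c k) * cis (real_of_int k * (real_vec m0 \<bullet> x + \<omega> * t))))"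
      unfolding infsum_cmult_right'[symmetric]
    proof (intro infsum_cong)
      fix k
      have "- c k = \<epsilon>\<^sup>2 * (bracket (k *s m0) powr \<alpha> * cube a k)"
        using eq[of k] by (simp add: c_def)
      then have "- complex_of_real (c k) =
          complex_of_real (\<epsilon>\<^sup>2) * (complex_of_real (bracket (k *s m0) powr \<alpha>) * complex_of_real (cube a k))"
        by (metis of_real_minus of_real_mult)
      then show "complex_of_real (\<epsilon>\<^sup>2) * (complex_of_real (bracket (k *s m0) powr \<alpha>) * q k *
        exp (\<i> * complex_of_real (real_vec (k *s m0) \<bullet> x))) =
        - (complex_of_real (c k) * cis (real_of_int k * (real_vec m0 \<bullet> x + \<omega> * t)))"
        unfolding q_def phase[symmetric] by (simp only: minus_mult_left mult.assoc)
    qed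
    also have "\<dots> = - complex_of_real (\<Sum>\<^sub>\<infinity>k. c k * cos (real_of_int k * (real_vec m0 \<bullet> x + \<omega> * t)))"
      unfolding infsum_uminus even_cis_series[OF c_even c_sum] ..
    finally show ?thesis .
  qed
  show ?thesis
    unfolding solves_nlw_def
  proof (intro conjI allI)
    show "smooth (travelling_wave m0 \<omega> a)"
      unfolding y by (rule smooth_plane[of "profile a", OF U L])
    fix x t
    show "travelling_wave m0 \<omega> a (x + axis j (2 * pi), t) = travelling_wave m0 \<omega> a (x, t)" for j
    proof -
      have "real_vec m0 \<bullet> (x + axis j (2 * pi)) + \<omega> * t =
          (real_vec m0 \<bullet> x + \<omega> * t) + 2 * pi * real_of_int (m0 $ j)"
        by (simp add: inner_add_right inner_axis)
      then show ?thesis unfolding travelling_wave_def by (simp only: prod.case profile_periodic)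
    qed
    have "complex_of_real (d_tt (travelling_wave m0 \<omega> a) (x, t) - laplacian_x (travelling_wave m0 \<omega> a) (x, t) +
        \<rho> * travelling_wave m0 \<omega> a (x, t)) =
        complex_of_real (\<Sum>\<^sub>\<infinity>k. c k * cos (real_of_int k * (real_vec m0 \<bullet> x + \<omega> * t)))"
      unfolding tt lap linear[symmetric] by (simp add: L_def travelling_wave_def)
    then show "complex_of_real (d_tt (travelling_wave m0 \<omega> a) (x, t) - laplacian_x (travelling_wave m0 \<omega> a) (x, t) +
        \<rho> * travelling_wave m0 \<omega> a (x, t)) +
        complex_of_real (\<epsilon>\<^sup>2) * frac_deriv \<alpha> (\<lambda>x'. complex_of_real (travelling_wave m0 \<omega> a (x', t) ^ 3)) x = 0"
      unfolding frac by simp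
  qed
qed

section \<open>Cantor sets of large measure\<close>

text \<open>Remove from \<open>{1..2}\<close> an open neighbourhood \<open>T\<close> of the rationals of measure less than \<open>e\<close>; the rest
  \<open>K\<close> is compact without interior. Keeping only the points of \<open>K\<close> all of whose neighbourhoods meet \<open>K\<close> in
  positive measure discards a null set and leaves no isolated points.\<close>

lemma fat_cantor_set:
  fixes e :: real
  assumes "0 < e" "e < 1"
  shows "\<exists>S. Cantor_type_set S \<and> S \<subseteq> {1..2} \<and> measure lebesgue ({1..2} - S) \<le> e"
proof -
  have Q: "(\<rat> :: real set) \<in> null_sets lebesgue"
    using countable_imp_null_set_lborel[OF countable_rat] null_sets_completionI by blast
  then have Qm: "(\<rat> :: real set) \<in> sets lebesgue" by auto
  obtain T :: "real set" where T: "open T" "\<rat> \<subseteq> T" "T - \<rat> \<in> lmeasurable" "emeasure lebesgue (T - \<rat>) < ennreal e"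
    by (rule sets_lebesgue_outer_open[OF Qm assms(1)])
  have Tm: "T \<in> lmeasurable"
  proof -
    have "T = (T - \<rat>) \<union> \<rat>" using T(2) by blast
    moreover have "(\<rat> :: real set) \<in> lmeasurable" using Q by (simp add: negligible_iff_null_sets[symmetric] negligible_imp_measurable)
    ultimately show ?thesis using T(3) fmeasurable.Un by metis
  qed
  have "measure lebesgue T = measure lebesgue (T - \<rat>)"
    using measure_Diff_null_set[OF fmeasurableD[OF Tm] Q] by simp
  also have "\<dots> < e"
    using T(3,4) assms(1) by (simp add: emeasure_eq_measure2 ennreal_less_iff)
  finally have Te: "measure lebesgue T < e" .
  define K where "K = {1..2} - T"
  have K: "closed K" using T(1) by (simp add: K_def closed_Diff)
  define S where "S = {x \<in> K. \<forall>d>0. \<not> negligible (K \<inter> ball x d)}"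
  have SK: "S \<subseteq> K" by (auto simp: S_def)
  have null: "negligible (K - S)"
    unfolding locally_negligible_alt[of "K - S"]
  proof
    fix x assume x: "x \<in> K - S"
    then obtain d where d: "d > 0" "negligible (K \<inter> ball x d)" by (auto simp: S_def)
    have "openin (top_of_set (K - S)) ((K - S) \<inter> ball x d)" by (simp add: openin_open_Int)
    moreover have "negligible ((K - S) \<inter> ball x d)" by (rule negligible_subset[OF d(2)]) auto
    ultimately show "\<exists>U. openin (top_of_set (K - S)) U \<and> x \<in> U \<and> negligible U"
      using x d(1) by (intro exI[of _ "(K - S) \<inter> ball x d"]) auto
  qed
  have meas: "measure lebesgue ({1..2} - S) \<le> e"
  proof -
    have KS: "K - S \<in> lmeasurable" by (rule negligible_imp_measurable[OF null])
    have IT: "{1..2} \<inter> T \<in> sets lebesgue" using fmeasurableD[OF Tm] by (intro sets.Int) auto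
    have "{1..2} - S = ({1..2} \<inter> T) \<union> (K - S)" using SK by (auto simp: K_def)
    then have "measure lebesgue ({1..2} - S) \<le> measure lebesgue ({1..2} \<inter> T) + measure lebesgue (K - S)"
      using measure_Un_le[of "{1..2} \<inter> T" lebesgue "K - S"] KS IT by (simp add: fmeasurableD)
    also have "measure lebesgue (K - S) = 0" by (rule negligible_imp_measure0[OF null])
    also have "measure lebesgue ({1..2} \<inter> T) \<le> measure lebesgue T"
      using Tm IT by (intro measure_mono_fmeasurable) auto
    finally show ?thesis using Te by simp
  qed
  have "closed S"
    unfolding closed_def open_dist
  proof (intro ballI)
    fix x assume x: "x \<in> - S"
    show "\<exists>e>0. \<forall>y. dist y x < e \<longrightarrow> y \<in> - S"
    proof (cases "x \<in> K")
      case False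
      then show ?thesis using K SK by (metis (no_types, opaque_lifting) ComplI closed_def open_dist subsetD ComplD)
    next
      case True
      then obtain d where d: "d > 0" "negligible (K \<inter> ball x d)" using x by (auto simp: S_def)
      have "y \<in> - S" if "dist y x < d / 2" for y
      proof -
        have "ball y (d / 2) \<subseteq> ball x d"
        proof
          fix z assume "z \<in> ball y (d / 2)"
          then have "\<bar>y - z\<bar> < d / 2" "\<bar>y - x\<bar> < d / 2"
            using that by (simp_all only: mem_ball dist_real_def)
          then show "z \<in> ball x d" unfolding mem_ball dist_real_def by linarith
        qed
        then have "negligible (K \<inter> ball y (d / 2))"
          by (intro negligible_subset[OF d(2)]) auto
        then show ?thesis using d(1) by (auto simp: S_def intro!: exI[of _ "d / 2"])
      qed
      then show ?thesis using d(1) by (intro exI[of _ "d / 2"]) auto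
    qed
  qed
  moreover have "S \<subseteq> {1..2}" using SK by (auto simp: K_def)
  ultimately have "compact S" by (metis bounded_closed_interval bounded_subset compact_eq_bounded_closed)
  moreover have "x islimpt S" if x: "x \<in> S" for x
    unfolding islimpt_approachable
  proof (intro allI impI)
    fix d :: real assume d: "0 < d"
    show "\<exists>y\<in>S. y \<noteq> x \<and> dist y x < d"
    proof (rule ccontr)
      assume "\<not> ?thesis"
      then have "K \<inter> ball x d \<subseteq> {x} \<union> (K - S)" by (auto simp: dist_commute)
      moreover have "negligible ({x} \<union> (K - S))" using null by simp
      ultimately have "negligible (K \<inter> ball x d)" using negligible_subset by blast
      then show False using x d by (auto simp: S_def)
    qed
  qed
  moreover have "interior S = {}"
  proof (rule ccontr)
    assume "interior S \<noteq> {}"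
    then obtain x where x: "x \<in> interior S" by blast
    then obtain d where d: "d > 0" "ball x d \<subseteq> S" by (auto simp: mem_interior)
    obtain q where q: "q \<in> \<rat>" "x < q" "q < x + d" using Rats_dense_in_real[of x "x + d"] d(1) by auto
    then have "q \<in> S" using d(2) by (auto simp: dist_real_def)
    then show False using q(1) T(2) SK by (auto simp: K_def)
  qed
  moreover have "S \<noteq> {}"
  proof
    assume "S = {}"
    then show False using meas assms(2) by simp
  qed
  ultimately show ?thesis using \<open>S \<subseteq> {1..2}\<close> meas unfolding Cantor_type_set_def by blast
qed

section \<open>Persistence of the travelling wave\<close>

lemma bracket_scale: "(bracket (k *s m))\<^sup>2 = 1 + (real_of_int k)\<^sup>2 * (norm (real_vec m))\<^sup>2"
proof -
  have "(bracket (k *s m))\<^sup>2 = 1 + (\<Sum>j\<in>UNIV. \<bar>real_of_int ((k *s m) $ j)\<bar>\<^sup>2)"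
    unfolding bracket_def by (rule real_sqrt_pow2) (intro add_nonneg_nonneg sum_nonneg, auto)
  then show ?thesis by (simp add: norm_real_vec_square sum_distrib_left power_mult_distrib)
qed

lemma bracket_ge_1: "1 \<le> bracket m"
  unfolding bracket_def by (simp add: sum_nonneg)

lemma bracket_powr_le:
  assumes "0 < \<alpha>" "\<alpha> < 1"
  shows "bracket (k *s m) powr \<alpha> \<le> (1 + (norm (real_vec m))\<^sup>2) * (1 + (real_of_int k)\<^sup>2)"
proof -
  have "bracket (k *s m) powr \<alpha> \<le> bracket (k *s m) powr 2"
    using assms bracket_ge_1 by (intro powr_mono) auto
  also have "\<dots> = (bracket (k *s m))\<^sup>2"
    using bracket_ge_1[of "k *s m"] by (simp add: powr_numeral)
  also have "\<dots> \<le> (1 + (norm (real_vec m))\<^sup>2) * (1 + (real_of_int k)\<^sup>2)"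
    by (simp add: bracket_scale algebra_simps)
  finally show ?thesis .
qed

lemma bracket_uminus: "bracket (- k *s m) = bracket (k *s m)"
  by (simp add: bracket_def)

text \<open>The absence of small divisors: away from \<open>k = 1\<close> and \<open>k = -1\<close> the divisor \<open>k\<^sup>2 - 1\<close> is comparable
  to \<open>1 + k\<^sup>2\<close>.\<close>

lemma non_resonance:
  fixes k :: int
  assumes "\<bar>k\<bar> \<noteq> 1"
  shows "1 + (real_of_int k)\<^sup>2 \<le> 3 * \<bar>(real_of_int k)\<^sup>2 - 1\<bar>"
proof (cases "k = 0")
  case False
  then have "2 \<le> \<bar>k\<bar>" using assms by linarith
  then have "2 \<le> \<bar>real_of_int k\<bar>" by linarith
  from power_mono[OF this, of 2] show ?thesis by simp
qed simp

lemma divisor_quotient_le: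
  fixes k :: int and \<rho> :: real
  assumes "\<rho> \<noteq> 0" "0 \<le> H" "\<bar>b\<bar> \<le> H * (1 + (real_of_int k)\<^sup>2)"
  shows "\<bar>b / (\<rho> * ((real_of_int k)\<^sup>2 - 1))\<bar> \<le> 3 * H / \<bar>\<rho>\<bar>"
proof (cases "\<bar>k\<bar> = 1")
  case True
  then have "(real_of_int k)\<^sup>2 = 1" by (metis abs_square_eq_1 of_int_1 of_int_abs)
  then show ?thesis using assms(1,2) by simp
next
  case False
  note nr = non_resonance[OF this]
  then have pos: "0 < \<bar>(real_of_int k)\<^sup>2 - 1\<bar>"
    using less_le_trans[OF one_plus_square_pos nr] by simp
  have "\<bar>b\<bar> \<le> H * (3 * \<bar>(real_of_int k)\<^sup>2 - 1\<bar>)"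
    using assms(3) mult_left_mono[OF nr assms(2)] by linarith
  then have "\<bar>b\<bar> / \<bar>(real_of_int k)\<^sup>2 - 1\<bar> \<le> 3 * H"
    using pos by (simp add: divide_le_eq mult_ac)
  from divide_right_mono[OF this, of "\<bar>\<rho>\<bar>"] show ?thesis
    by (simp add: abs_divide abs_mult mult.commute)
qed

text \<open>The coefficients on \<open>\<int>\<^sup>d \<times> \<int>\<close> of a function of the phase \<open>m0 \<bullet> x + \<omega> * t\<close>: they live on the
  line spanned by \<open>(m0, 1)\<close>.\<close>

definition ray_coeff :: "int ^ 'd::finite \<Rightarrow> (int \<Rightarrow> real) \<Rightarrow> int ^ 'd \<Rightarrow> int \<Rightarrow> real" where
  "ray_coeff m0 a m n = (if m = n *s m0 then a n else 0)"

lemma cos_series_ray: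
  fixes m0 :: "int ^ 'd::finite"
  shows "cos_series (ray_coeff m0 a) \<omega> = travelling_wave m0 \<omega> a"
proof
  fix z :: "(real ^ 'd) \<times> real"
  obtain x t where z: "z = (x, t)" by (cases z)
  let ?\<phi> = "\<lambda>k::int. (k *s m0, k)"
  let ?g = "\<lambda>(m, n). ray_coeff m0 a m n * cos (real_vec m \<bullet> x + real_of_int n * \<omega> * t)"
  have "cos_series (ray_coeff m0 a) \<omega> z = infsum ?g UNIV"
    by (simp add: cos_series_def z)
  also have "\<dots> = infsum ?g (range ?\<phi>)"
    by (rule infsum_cong_neutral) (auto simp: ray_coeff_def)
  also have "\<dots> = infsum (?g \<circ> ?\<phi>) UNIV"
    by (rule infsum_reindex) (auto intro: injI)
  also have "?g \<circ> ?\<phi> = (\<lambda>k. a k * cos (real_of_int k * (real_vec m0 \<bullet> x + \<omega> * t)))"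
    by (auto simp: ray_coeff_def real_vec_scale algebra_simps)
  finally show "cos_series (ray_coeff m0 a) \<omega> z = travelling_wave m0 \<omega> a z"
    by (simp add: travelling_wave_def profile_0 z)
qed

lemma cos_wave_eq_travelling_wave: "cos_wave m0 \<omega> p = travelling_wave m0 \<omega> (single_mode p)"
proof -
  have "profile (single_mode p) 0 \<theta> = p * cos \<theta>" for \<theta>
  proof -
    have "profile (single_mode p) 0 \<theta> = (\<Sum>\<^sub>\<infinity>k\<in>{1, -1}. single_mode p k * cos (real_of_int k * \<theta>))"
      unfolding profile_0 by (rule infsum_cong_neutral) (auto simp: single_mode_def)
    then show ?thesis by (simp add: single_mode_def)
  qed
  then show ?thesis by (auto simp: cos_wave_def travelling_wave_def)
qed

lemma cos_wave_solves_linear: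
  fixes m0 :: "int ^ 'd::finite"
  assumes "m0 \<noteq> 0" "0 < (norm (real_vec m0))\<^sup>2 + \<rho>"
  shows "solves_nlw \<alpha> \<rho> 0 (cos_wave m0 (sqrt ((norm (real_vec m0))\<^sup>2 + \<rho>)) p)"
  unfolding cos_wave_eq_travelling_wave
proof (rule travelling_wave_solves[OF assms(1) _ wbound_single_mode[of 1 p]])
  fix k
  have "\<bar>k\<bar> = 1 \<Longrightarrow> (real_of_int k)\<^sup>2 = 1" by (metis abs_square_eq_1 of_int_1 of_int_abs)
  then show "((real_of_int k)\<^sup>2 * ((norm (real_vec m0))\<^sup>2 - (sqrt ((norm (real_vec m0))\<^sup>2 + \<rho>))\<^sup>2) + \<rho>) *
      single_mode p k + 0\<^sup>2 * (bracket (k *s m0) powr \<alpha> * cube (single_mode p) k) = 0"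
    using assms(2) by (simp add: single_mode_def)
qed (auto simp: single_mode_def)

text \<open>On the line, \<open>norm1 (k m0) k = s * |k|\<close> with \<open>s = norm1 m0 1\<close>, and \<open>(s * |k|) powr c \<le> 1 + s * |k|\<close>
  because \<open>c < 1\<close>. With this \<open>s\<close> in the weight, its exponential factor cancels the Gevrey factor exactly, and
  \<open>\<Sum>k. 1 / (1 + k\<^sup>2)\<close> remains.\<close>

lemma ray_gevrey_bound:
  fixes m0 :: "int ^ 'd::finite"
  assumes "0 < c" "c < 1" and s: "s = norm1 m0 1" and p: "a 1 = p / 2" "a (- 1) = p / 2"
    and bnd: "wbound s E (\<lambda>k. a k - single_mode p k)"
  defines "w \<equiv> \<lambda>(m, n). \<bar>ray_coeff m0 a m n\<bar> * exp (norm1 m n powr c)"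
    and "S \<equiv> UNIV - {(m0, 1), (- m0, - 1)}"
  shows "w summable_on S" "infsum w S \<le> E * (exp 1 * inverse_square_sum)"
proof -
  let ?\<phi> = "\<lambda>k::int. (k *s m0, k)"
  let ?g = "\<lambda>k::int. E * exp 1 * (1 / (1 + (real_of_int k)\<^sup>2))"
  define N where "N = {k::int. \<bar>k\<bar> \<noteq> 1}"
  have s0: "0 \<le> s" by (simp add: s norm1_def sum_nonneg add_nonneg_nonneg)
  have norm1_ray: "norm1 (k *s m0) k = s * \<bar>real_of_int k\<bar>" for k
    by (simp add: s norm1_def abs_mult sum_distrib_left algebra_simps)
  have inj: "inj_on ?\<phi> N" by (auto intro: inj_onI)
  have sub: "?\<phi> ` N \<subseteq> S" by (auto simp: N_def S_def)
  have zero: "w z = 0" if "z \<in> S - ?\<phi> ` N" for z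
  proof -
    obtain m n where z: "z = (m, n)" by (cases z)
    have "m \<noteq> n *s m0"
    proof
      assume m: "m = n *s m0"
      then have "n \<notin> N" using that z by auto
      then have "n = 1 \<or> n = - 1" by (auto simp: N_def)
      then have "z = (m0, 1) \<or> z = (- m0, - 1)"
        using m z by (auto simp: vec_eq_iff)
      then show False using that by (auto simp: S_def)
    qed
    then show ?thesis by (simp add: w_def ray_coeff_def z)
  qed
  have term_le: "\<bar>(w \<circ> ?\<phi>) k\<bar> \<le> ?g k" if "k \<in> N" for k
  proof -
    let ?x = "s * \<bar>real_of_int k\<bar>"
    have x: "?x powr c \<le> 1 + ?x"
    proof (cases "?x \<le> 1")
      case True
      then have "?x powr c \<le> 1" using s0 assms(1) powr_mono2[of c ?x 1] by simp
      then show ?thesis using s0 by (smt (verit) mult_nonneg_nonneg abs_ge_zero)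
    next
      case False
      then show ?thesis using assms(2) powr_mono[of c 1 ?x] s0 by simp
    qed
    have "\<bar>(w \<circ> ?\<phi>) k\<bar> = \<bar>a k\<bar> * exp (?x powr c)"
      by (simp add: w_def ray_coeff_def norm1_ray)
    also have "\<dots> \<le> (E * weight s k) * exp (1 + ?x)"
      using wboundD[OF bnd, of k] that x by (intro mult_mono) (auto simp: N_def single_mode_def)
    also have "\<dots> = ?g k" by (simp add: weight_def exp_add exp_minus)
    finally show ?thesis .
  qed
  have gs: "?g summable_on UNIV"
    by (intro summable_on_cmult_right summable_inverse_square_int)
  have wN: "(w \<circ> ?\<phi>) summable_on N"
  proof (rule abs_summable_summable)
    show "(\<lambda>k. norm ((w \<circ> ?\<phi>) k)) summable_on N"
      using term_le by (intro summable_on_comparison_test[OF summable_on_subset_banach[OF gs]]) auto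
  qed
  then have "w summable_on ?\<phi> ` N" by (subst summable_on_reindex[OF inj])
  then show "w summable_on S"
    using summable_on_cong_neutral[of S "?\<phi> ` N" w w] zero sub by blast
  have "infsum w S = infsum w (?\<phi> ` N)"
    by (rule infsum_cong_neutral) (use zero sub in auto)
  also have "\<dots> = infsum (w \<circ> ?\<phi>) N" by (rule infsum_reindex[OF inj])
  also have "\<dots> \<le> infsum ?g UNIV"
    using term_le wbound_nonneg[OF bnd] by (intro infsum_mono_neutral[OF wN gs]) (auto intro: order_trans[OF abs_ge_self])
  also have "\<dots> = E * (exp 1 * inverse_square_sum)"
    unfolding infsum_cmult_right' inverse_square_sum_def by simp
  finally show "infsum w S \<le> E * (exp 1 * inverse_square_sum)" .
qed

text \<open>From \<open>(sqrt v - L) * (sqrt v + L) = v - L\<^sup>2\<close> and \<open>sqrt v + L \<ge> L\<close>.\<close>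

lemma sqrt_perturbation:
  fixes v L d :: real
  assumes "0 < L" "\<bar>v - L\<^sup>2\<bar> \<le> d * L"
    and "d < L"
  shows "0 < v" "\<bar>sqrt v - L\<bar> \<le> d"
proof -
  have "d * L < L * L" using assms by simp
  then show v: "0 < v" using assms(2) by (simp add: power2_eq_square abs_le_iff)
  have "\<bar>sqrt v - L\<bar> * L \<le> \<bar>sqrt v - L\<bar> * (sqrt v + L)"
    using v by (intro mult_left_mono) auto
  also have "\<dots> = \<bar>(sqrt v - L) * (sqrt v + L)\<bar>"
    using v assms(1) by (simp add: abs_mult)
  also have "(sqrt v - L) * (sqrt v + L) = v - L\<^sup>2"
    using v by (simp add: algebra_simps power2_eq_square)
  finally show "\<bar>sqrt v - L\<bar> \<le> d" using assms(1,2) by (meson mult_right_le_imp_le order_trans)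
qed

text \<open>The construction outlined at the beginning. Here \<open>\<beta>\<close> and \<open>\<kappa>\<close> are the coefficients of the mode
  equations after division by \<open>\<rho> * (k\<^sup>2 - 1)\<close>, and \<open>\<nu>\<close> is the frequency shift: \<open>\<omega>\<^sup>2 = |m0|\<^sup>2 + \<rho> + \<epsilon>\<^sup>2 * \<nu>\<close>.\<close>

lemma persistence:
  fixes m0 :: "int ^ 'd::finite"
  assumes m0: "m0 \<noteq> 0" and pos: "0 < (norm (real_vec m0))\<^sup>2 + \<rho>" and \<rho>: "\<rho> \<noteq> 0"
    and \<alpha>: "0 < \<alpha>" "\<alpha> < 1" and c: "0 < c" "c < 1"
  shows "\<exists>\<epsilon>0>0. \<exists>K. \<forall>\<epsilon> p. 0 < \<epsilon> \<longrightarrow> \<epsilon> < \<epsilon>0 \<longrightarrow> 1 \<le> p \<longrightarrow> p \<le> 2 \<longrightarrow>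
    (\<exists>\<omega>. persists_with_frequency 1 c \<alpha> \<rho> \<epsilon> m0 p \<omega> \<and>
      \<bar>\<omega>\<^sup>2 - ((norm (real_vec m0))\<^sup>2 + \<rho> + 3 / 4 * bracket m0 powr \<alpha> * p\<^sup>2 * \<epsilon>\<^sup>2)\<bar>
        \<le> K * \<epsilon> powr (17 / 8))"
proof -
  define h where "h = 1 + (norm (real_vec m0))\<^sup>2"
  define B where "B k = bracket (k *s m0) powr \<alpha>" for k :: int
  \<comment> \<open>The decay rate of the weight is matched to the Gevrey factor on the line spanned by \<open>(m0, 1)\<close>.\<close>
  define s where "s = norm1 m0 1"
  define l0 where "l0 = sqrt ((norm (real_vec m0))\<^sup>2 + \<rho>)"
  have h: "1 \<le> h" by (simp add: h_def)
  have s: "0 < s" by (simp add: s_def norm1_def sum_nonneg add_nonneg_pos)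
  have l0: "0 < l0" "l0\<^sup>2 = (norm (real_vec m0))\<^sup>2 + \<rho>" using pos by (simp_all add: l0_def)
  have B: "\<bar>B k\<bar> \<le> h * (1 + (real_of_int k)\<^sup>2)" for k
    using bracket_powr_le[OF \<alpha>, of k m0] by (simp add: B_def h_def)
  have B1: "\<bar>B 1\<bar> \<le> 2 * h" using B[of 1] by simp
  have B1': "B 1 = bracket m0 powr \<alpha>" by (simp add: B_def)
  have B_even: "B (- k) = B k" for k by (simp add: B_def bracket_uminus)
  \<comment> \<open>The factor 4 accommodates \<open>\<kappa>\<close>, where \<open>|B 1| \<le> 2 * h\<close> and \<open>2 / p \<le> 2\<close>.\<close>
  define M where "M = 3 * (4 * h) / \<bar>\<rho>\<bar>"
  have M: "0 \<le> M" using h by (simp add: M_def)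
  obtain A K \<eta>0 where A: "0 \<le> A" and K: "0 \<le> K" and \<eta>0: "0 < \<eta>0"
    and sol: "\<forall>p \<eta> \<beta> \<kappa>. \<bar>p\<bar> \<le> 2 \<longrightarrow> 0 < \<eta> \<longrightarrow> \<eta> < \<eta>0 \<longrightarrow>
      (\<forall>k. \<bar>\<beta> k\<bar> \<le> M) \<longrightarrow> (\<forall>k. \<bar>\<kappa> k\<bar> \<le> M) \<longrightarrow>
      (\<forall>k. \<beta> (- k) = \<beta> k) \<longrightarrow> (\<forall>k. \<kappa> (- k) = \<kappa> k) \<longrightarrow>
      (\<exists>a. wbound s A a \<and> (\<forall>k. a (- k) = a k) \<and> a 1 = p / 2 \<and>
        (\<forall>k. \<bar>k\<bar> \<noteq> 1 \<longrightarrow> a k = \<eta> * (\<beta> k * cube a k - \<kappa> k * cube a 1 * a k)) \<and>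
        wbound s (\<eta> * K) (\<lambda>k. a k - single_mode p k))"
    by (rule mode_equation_solution[OF less_imp_le[OF s] M])
  \<comment> \<open>\<open>J1\<close>, \<open>J2\<close>, \<open>J3\<close> bound the frequency shift, its deviation from the single mode value, and the Gevrey sum, each up to powers of \<open>\<epsilon>\<close>.\<close>
  define J1 where "J1 = 2 * h * (16 * inverse_square_sum\<^sup>2 * A ^ 3) * 2"
  define J2 where "J2 = 2 * h * (48 * inverse_square_sum\<^sup>2 * (A + K)\<^sup>2 * K) * 2"
  define J3 where "J3 = K * (exp 1 * inverse_square_sum)"
  have J: "0 \<le> J1" "0 \<le> J2" "0 \<le> J3"
    using h A K inverse_square_sum_nonneg by (simp_all add: J1_def J2_def J3_def)
  define \<epsilon>0 where "\<epsilon>0 = Min {1, \<eta>0, l0, l0 / (J1 + 1), 1 / (J3 + 1)}"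
  have \<epsilon>0: "0 < \<epsilon>0" using \<eta>0 l0 J by (simp add: \<epsilon>0_def)
  have main: "\<exists>\<omega>. persists_with_frequency 1 c \<alpha> \<rho> \<epsilon> m0 p \<omega> \<and>
      \<bar>\<omega>\<^sup>2 - ((norm (real_vec m0))\<^sup>2 + \<rho> + 3 / 4 * bracket m0 powr \<alpha> * p\<^sup>2 * \<epsilon>\<^sup>2)\<bar>
        \<le> J2 * \<epsilon> powr (17 / 8)"
    if \<epsilon>: "0 < \<epsilon>" "\<epsilon> < \<epsilon>0" and p: "1 \<le> p" "p \<le> 2" for \<epsilon> p
  proof -
    have small: "\<epsilon> < 1" "\<epsilon> < \<eta>0" "\<epsilon> < l0" "\<epsilon> < l0 / (J1 + 1)" "\<epsilon> < 1 / (J3 + 1)"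
      using \<epsilon>(2) by (simp_all add: \<epsilon>0_def)
    have \<epsilon>2: "0 < \<epsilon>\<^sup>2" "\<epsilon>\<^sup>2 \<le> \<epsilon>"
      using \<epsilon>(1) small(1) by (simp_all add: power2_eq_square mult_left_le)
    then have \<epsilon>2': "\<epsilon>\<^sup>2 < \<eta>0" "\<epsilon>\<^sup>2 \<le> 1" using small(1,2) by linarith+
    define \<beta> where "\<beta> k = B k / (\<rho> * ((real_of_int k)\<^sup>2 - 1))" for k
    define \<kappa> where "\<kappa> k = (real_of_int k)\<^sup>2 * B 1 * (2 / p) / (\<rho> * ((real_of_int k)\<^sup>2 - 1))" for k
    have \<beta>: "\<bar>\<beta> k\<bar> \<le> M" for k
    proof -
      have "\<bar>B k\<bar> \<le> 4 * h * (1 + (real_of_int k)\<^sup>2)"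
        using B[of k] by (smt (verit) h mult_right_mono one_plus_square_pos)
      then show ?thesis unfolding \<beta>_def M_def using h by (intro divisor_quotient_le \<rho>) auto
    qed
    have \<kappa>: "\<bar>\<kappa> k\<bar> \<le> M" for k
    proof -
      have "\<bar>(real_of_int k)\<^sup>2 * B 1 * (2 / p)\<bar> = (real_of_int k)\<^sup>2 * (\<bar>B 1\<bar> * (2 / p))"
        using p by (simp add: abs_mult)
      also have "\<dots> \<le> (1 + (real_of_int k)\<^sup>2) * (2 * h * 2)"
        using p h by (intro mult_mono B1) (auto simp: divide_le_eq)
      finally show ?thesis unfolding \<kappa>_def M_def using h
        by (intro divisor_quotient_le \<rho>) (auto simp: mult_ac)
    qed
    obtain a where a: "wbound s A a" and even: "\<And>k. a (- k) = a k" and a1: "a 1 = p / 2"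
      and mode: "\<And>k. \<bar>k\<bar> \<noteq> 1 \<Longrightarrow> a k = \<epsilon>\<^sup>2 * (\<beta> k * cube a k - \<kappa> k * cube a 1 * a k)"
      and near: "wbound s (\<epsilon>\<^sup>2 * K) (\<lambda>k. a k - single_mode p k)"
      using sol[rule_format, of p "\<epsilon>\<^sup>2" \<beta> \<kappa>] p \<epsilon>2(1) \<epsilon>2'(1) \<beta> \<kappa> by (auto simp: \<beta>_def \<kappa>_def B_even)
    define q where "q = cube a 1"
    define \<nu> where "\<nu> = B 1 * q * (2 / p)"
    define \<omega> where "\<omega> = sqrt (l0\<^sup>2 + \<epsilon>\<^sup>2 * \<nu>)"
    have \<nu>_bound: "\<bar>B 1 * x * (2 / p)\<bar> \<le> 2 * h * X * 2" if "\<bar>x\<bar> \<le> X" for x X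
    proof -
      have "\<bar>B 1 * x * (2 / p)\<bar> = \<bar>B 1\<bar> * \<bar>x\<bar> * (2 / p)" using p by (simp add: abs_mult)
      also have "\<dots> \<le> 2 * h * X * 2"
        using p h that by (intro mult_mono B1 that) (auto simp: divide_le_eq)
      finally show ?thesis .
    qed
    have le1: "\<bar>f 1\<bar> \<le> X" if "wbound s X f" for f X
      using wboundD[OF that, of 1] mult_left_mono[OF weight_le_1[OF less_imp_le[OF s], of 1] wbound_nonneg[OF that]]
      by simp
    have "\<bar>q\<bar> \<le> 16 * inverse_square_sum\<^sup>2 * A ^ 3"
      unfolding q_def using s by (intro le1 wbound_cube a) auto
    then have \<nu>: "\<bar>\<nu>\<bar> \<le> J1" unfolding \<nu>_def J1_def by (rule \<nu>_bound)
    have J1l0: "\<epsilon> * J1 < l0"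
      using small(4) J(1) \<epsilon>(1) by (simp add: less_divide_eq algebra_simps)
    have "\<bar>(l0\<^sup>2 + \<epsilon>\<^sup>2 * \<nu>) - l0\<^sup>2\<bar> \<le> \<epsilon>\<^sup>2 * J1 / l0 * l0"
      using \<nu> l0 \<epsilon>2(1) by (simp add: abs_mult)
    moreover have eps_lt: "\<epsilon>\<^sup>2 * J1 / l0 < \<epsilon>"
      using mult_strict_left_mono[OF J1l0 \<epsilon>(1)] l0(1) by (simp add: divide_less_eq power2_eq_square mult_ac)
    ultimately have \<omega>: "0 < l0\<^sup>2 + \<epsilon>\<^sup>2 * \<nu>" "\<bar>\<omega> - l0\<bar> < \<epsilon>"
      unfolding \<omega>_def using sqrt_perturbation[OF l0(1), of "l0\<^sup>2 + \<epsilon>\<^sup>2 * \<nu>" "\<epsilon>\<^sup>2 * J1 / l0"] small(3)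
      by linarith+
    have \<omega>2: "\<omega>\<^sup>2 = (norm (real_vec m0))\<^sup>2 + \<rho> + \<epsilon>\<^sup>2 * \<nu>"
      using \<omega>(1) l0 by (simp add: \<omega>_def)
    have solves: "solves_nlw \<alpha> \<rho> \<epsilon> (cos_series (ray_coeff m0 a) \<omega>)"
      unfolding cos_series_ray
    proof (rule travelling_wave_solves[OF m0 s a even])
      fix k
      show "((real_of_int k)\<^sup>2 * ((norm (real_vec m0))\<^sup>2 - \<omega>\<^sup>2) + \<rho>) * a k +
        \<epsilon>\<^sup>2 * (bracket (k *s m0) powr \<alpha> * cube a k) = 0"
      proof (cases "\<bar>k\<bar> = 1")
        case True
        then have k: "k = 1 \<or> k = - 1" by auto
        then have "(real_of_int k)\<^sup>2 = 1" "a k = p / 2" "cube a k = q" "B k = B 1"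
          using a1 even[of 1] cube_even[of a 1, OF even] B_even[of 1] by (auto simp: q_def)
        then show ?thesis using p by (simp add: B_def[symmetric] \<omega>2 \<nu>_def field_simps)
      next
        case False
        define r where "r = (real_of_int k)\<^sup>2 - 1"
        have r: "r \<noteq> 0"
          using less_le_trans[OF one_plus_square_pos non_resonance[OF False]] by (simp add: r_def)
        have "a k * (\<rho> * r) = \<epsilon>\<^sup>2 * ((\<beta> k * (\<rho> * r)) * cube a k - (\<kappa> k * (\<rho> * r)) * q * a k)"
          by (subst mode[OF False]) (simp add: q_def algebra_simps)
        also have "\<beta> k * (\<rho> * r) = B k" using r \<rho> by (simp add: \<beta>_def r_def)
        also have "\<kappa> k * (\<rho> * r) = (real_of_int k)\<^sup>2 * B 1 * (2 / p)" using r \<rho> by (simp add: \<kappa>_def r_def)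
        finally show ?thesis by (simp add: B_def[symmetric] \<omega>2 \<nu>_def r_def algebra_simps)
      qed
    qed
    have am1: "a (- 1) = p / 2" using even[of 1] a1 by simp
    note gevrey = ray_gevrey_bound[OF c s_def a1 am1 near]
    have "\<epsilon>\<^sup>2 * K * (exp 1 * inverse_square_sum) = \<epsilon> * (\<epsilon> * J3)"
      by (simp add: J3_def power2_eq_square)
    also have "\<dots> < \<epsilon> * 1"
      using small(5) J(3) \<epsilon>(1) by (intro mult_strict_left_mono) (simp_all add: less_divide_eq algebra_simps)
    also have "\<dots> \<le> \<epsilon> powr (1 / 8)"
      using powr_mono'[of "1 / 8" 1 \<epsilon>] small(1) \<epsilon>(1) by simp
    finally have small_sum: "\<epsilon>\<^sup>2 * K * (exp 1 * inverse_square_sum) < \<epsilon> powr (1 / 8)" .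
    have persists: "persists_with_frequency 1 c \<alpha> \<rho> \<epsilon> m0 p \<omega>"
      unfolding persists_with_frequency_def Let_def
    proof (intro exI[of _ "ray_coeff m0 a"] conjI solves allI)
      show "ray_coeff m0 a m0 1 = p / 2" by (simp add: ray_coeff_def a1)
      show "ray_coeff m0 a (- m0) (- 1) = p / 2" by (simp add: ray_coeff_def am1 vec_eq_iff)
      show "ray_coeff m0 a m n = ray_coeff m0 a (- m) (- n)" for m n
        by (simp add: ray_coeff_def even vec_eq_iff)
      show "\<bar>\<omega> - sqrt ((norm (real_vec m0))\<^sup>2 + \<rho>)\<bar> < 1 * \<epsilon>"
        using \<omega>(2) by (simp add: l0_def)
    qed (use gevrey small_sum in auto)
    have "wbound s (A + \<epsilon>\<^sup>2 * K) (\<lambda>k. a k - (a k - single_mode p k))"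
      by (rule wbound_diff[OF a near])
    then have "wbound s (A + \<epsilon>\<^sup>2 * K) (single_mode p)" by simp
    then have single: "wbound s (A + K) (single_mode p)"
      using \<epsilon>2'(2) K by (intro wbound_mono[of s "A + \<epsilon>\<^sup>2 * K" _ "A + K"]) (auto simp: mult_right_le_one_le mult_left_le_one_le)
    have aAK: "wbound s (A + K) a" using K by (intro wbound_mono[OF a]) simp
    have "\<bar>cube a 1 - cube (single_mode p) 1\<bar> \<le> 48 * inverse_square_sum\<^sup>2 * (A + K)\<^sup>2 * (\<epsilon>\<^sup>2 * K)"
      using s by (intro le1[where f = "\<lambda>k. cube a k - cube (single_mode p) k"] wbound_cube_diff aAK single near) auto
    then have "\<bar>B 1 * (q - 3 / 8 * p ^ 3) * (2 / p)\<bar> \<le>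
        2 * h * (48 * inverse_square_sum\<^sup>2 * (A + K)\<^sup>2 * (\<epsilon>\<^sup>2 * K)) * 2"
      by (intro \<nu>_bound) (simp add: q_def cube_single_mode)
    also have "\<dots> = J2 * \<epsilon>\<^sup>2" by (simp add: J2_def)
    finally have "\<epsilon>\<^sup>2 * \<bar>B 1 * (q - 3 / 8 * p ^ 3) * (2 / p)\<bar> \<le> \<epsilon>\<^sup>2 * (J2 * \<epsilon>\<^sup>2)"
      by (rule mult_left_mono) simp
    also have "\<dots> = J2 * \<epsilon> powr 4"
      using \<epsilon>(1) by (simp add: powr_numeral power2_eq_square power4_eq_xxxx)
    also have "\<dots> \<le> J2 * \<epsilon> powr (17 / 8)"
      using powr_mono'[of "17 / 8" 4 \<epsilon>] small(1) \<epsilon>(1) J(2) by (intro mult_left_mono) auto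
    finally have fine: "\<epsilon>\<^sup>2 * \<bar>B 1 * (q - 3 / 8 * p ^ 3) * (2 / p)\<bar> \<le> J2 * \<epsilon> powr (17 / 8)" .
    have "\<omega>\<^sup>2 - ((norm (real_vec m0))\<^sup>2 + \<rho> + 3 / 4 * B 1 * p\<^sup>2 * \<epsilon>\<^sup>2) =
        \<epsilon>\<^sup>2 * (B 1 * (q - 3 / 8 * p ^ 3) * (2 / p))"
      unfolding \<omega>2 \<nu>_def using p by (simp add: field_simps power2_eq_square power3_eq_cube)
    then have "\<bar>\<omega>\<^sup>2 - ((norm (real_vec m0))\<^sup>2 + \<rho> + 3 / 4 * B 1 * p\<^sup>2 * \<epsilon>\<^sup>2)\<bar> \<le> J2 * \<epsilon> powr (17 / 8)"
      using fine by (simp add: abs_mult)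
    then show ?thesis using persists unfolding B1' by blast
  qed
  show ?thesis
    using \<epsilon>0 main by blast
qed

theorem theorem1p1:
  fixes m0 :: "int ^ 'd::finite"
  assumes "m0 \<noteq> 0"
  shows "\<exists>C :: real \<Rightarrow> real. \<forall>\<rho> \<gamma> Ct :: real.
    (norm (real_vec m0))\<^sup>2 + \<rho> > 0 \<longrightarrow> \<gamma> > 0 \<longrightarrow> Ct > 0 \<longrightarrow>
    (\<forall>n k :: int. n \<noteq> 0 \<longrightarrow>
       \<bar>real_of_int n * \<rho> - real_of_int k\<bar> > \<gamma> * \<bar>real_of_int n\<bar> powr (- 2 * real CARD('d))) \<longrightarrow>
    (\<forall>a :: nat \<Rightarrow> int. (\<exists>k \<le> 10 * CARD('d). a k \<noteq> 0) \<longrightarrow>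
       \<bar>\<Sum>k\<le>10 * CARD('d). real_of_int (a k) * sqrt (\<rho> + (norm (real_vec m0))\<^sup>2) ^ k\<bar>
         > \<gamma> * (\<Sum>k\<le>10 * CARD('d). \<bar>real_of_int (a k)\<bar>) powr (- Ct)) \<longrightarrow>
    (\<exists>\<alpha>0>0. \<exists>c0>0. \<forall>\<alpha> c :: real. 0 < \<alpha> \<and> \<alpha> < \<alpha>0 \<and> 0 < c \<and> c < c0 \<longrightarrow>
      (\<exists>\<epsilon>0>0. \<exists>K :: real. \<exists>I :: real \<Rightarrow> real set.
        (\<forall>\<epsilon>. 0 < \<epsilon> \<and> \<epsilon> < \<epsilon>0 \<longrightarrow>
           Cantor_type_set (I \<epsilon>) \<and> I \<epsilon> \<subseteq> {1..2} \<and>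
           (\<forall>p0 \<in> I \<epsilon>.
              solves_nlw \<alpha> \<rho> 0 (cos_wave m0 (sqrt ((norm (real_vec m0))\<^sup>2 + \<rho>)) p0) \<and>
              (\<exists>\<omega>. persists_with_frequency (C \<alpha>) c \<alpha> \<rho> \<epsilon> m0 p0 \<omega> \<and>
                   \<bar>\<omega>\<^sup>2 - ((norm (real_vec m0))\<^sup>2 + \<rho>
                          + 3 / 4 * bracket m0 powr \<alpha> * p0\<^sup>2 * \<epsilon>\<^sup>2)\<bar>
                     \<le> K * \<epsilon> powr (17 / 8)))) \<and>
        ((\<lambda>\<epsilon>. measure lebesgue ({1..2} - I \<epsilon>)) \<longlongrightarrow> 0) (at_right 0)))"
proof (intro exI[of _ "\<lambda>_. 1"] allI impI, goal_cases)
  case (1 \<rho> \<gamma> Ct)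
  have \<rho>: "\<rho> \<noteq> 0" using 1(4)[rule_format, of 1 0] 1(2) by auto
  have core: "\<exists>\<epsilon>0>0. \<exists>K :: real. \<exists>I :: real \<Rightarrow> real set.
        (\<forall>\<epsilon>. 0 < \<epsilon> \<and> \<epsilon> < \<epsilon>0 \<longrightarrow>
           Cantor_type_set (I \<epsilon>) \<and> I \<epsilon> \<subseteq> {1..2} \<and>
           (\<forall>p0 \<in> I \<epsilon>.
              solves_nlw \<alpha> \<rho> 0 (cos_wave m0 (sqrt ((norm (real_vec m0))\<^sup>2 + \<rho>)) p0) \<and>
              (\<exists>\<omega>. persists_with_frequency 1 c \<alpha> \<rho> \<epsilon> m0 p0 \<omega> \<and>
                   \<bar>\<omega>\<^sup>2 - ((norm (real_vec m0))\<^sup>2 + \<rho>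
                          + 3 / 4 * bracket m0 powr \<alpha> * p0\<^sup>2 * \<epsilon>\<^sup>2)\<bar>
                     \<le> K * \<epsilon> powr (17 / 8)))) \<and>
        ((\<lambda>\<epsilon>. measure lebesgue ({1..2} - I \<epsilon>)) \<longlongrightarrow> 0) (at_right 0)"
    if params: "0 < \<alpha>" "\<alpha> < 1" "0 < c" "c < 1" for \<alpha> c :: real
  proof -
    obtain \<epsilon>0 K where \<epsilon>0: "0 < \<epsilon>0" and per: "\<And>\<epsilon> p. 0 < \<epsilon> \<Longrightarrow> \<epsilon> < \<epsilon>0 \<Longrightarrow> 1 \<le> p \<Longrightarrow> p \<le> 2 \<Longrightarrow>
      \<exists>\<omega>. persists_with_frequency 1 c \<alpha> \<rho> \<epsilon> m0 p \<omega> \<and>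
        \<bar>\<omega>\<^sup>2 - ((norm (real_vec m0))\<^sup>2 + \<rho> + 3 / 4 * bracket m0 powr \<alpha> * p\<^sup>2 * \<epsilon>\<^sup>2)\<bar>
          \<le> K * \<epsilon> powr (17 / 8)"
      using persistence[OF assms 1(1) \<rho> params] by metis
    obtain I :: "real \<Rightarrow> real set" where I: "\<And>\<epsilon>. 0 < \<epsilon> \<Longrightarrow> \<epsilon> < 1 \<Longrightarrow>
        Cantor_type_set (I \<epsilon>) \<and> I \<epsilon> \<subseteq> {1..2} \<and> measure lebesgue ({1..2} - I \<epsilon>) \<le> \<epsilon>"
      using fat_cantor_set by metis
    have "((\<lambda>\<epsilon>. measure lebesgue ({1..2} - I \<epsilon>)) \<longlongrightarrow> 0) (at_right 0)"
    proof (rule tendsto_sandwich[of "\<lambda>_. 0" _ _ "\<lambda>\<epsilon>. \<epsilon>"])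
      show "\<forall>\<^sub>F \<epsilon> in at_right 0. measure lebesgue ({1..2} - I \<epsilon>) \<le> \<epsilon>"
        unfolding eventually_at_right_field by (intro exI[of _ 1]) (use I in auto)
    qed (auto intro: tendsto_ident_at)
    moreover have "\<forall>\<epsilon>. 0 < \<epsilon> \<and> \<epsilon> < min \<epsilon>0 1 \<longrightarrow>
           Cantor_type_set (I \<epsilon>) \<and> I \<epsilon> \<subseteq> {1..2} \<and>
           (\<forall>p0 \<in> I \<epsilon>.
              solves_nlw \<alpha> \<rho> 0 (cos_wave m0 (sqrt ((norm (real_vec m0))\<^sup>2 + \<rho>)) p0) \<and>
              (\<exists>\<omega>. persists_with_frequency 1 c \<alpha> \<rho> \<epsilon> m0 p0 \<omega> \<and>
                   \<bar>\<omega>\<^sup>2 - ((norm (real_vec m0))\<^sup>2 + \<rho>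
                          + 3 / 4 * bracket m0 powr \<alpha> * p0\<^sup>2 * \<epsilon>\<^sup>2)\<bar>
                     \<le> K * \<epsilon> powr (17 / 8)))"
    proof (intro allI impI)
      fix \<epsilon> assume \<epsilon>: "0 < \<epsilon> \<and> \<epsilon> < min \<epsilon>0 1"
      then have "Cantor_type_set (I \<epsilon>)" "I \<epsilon> \<subseteq> {1..2}" using I[of \<epsilon>] by auto
      moreover have "1 \<le> p0" "p0 \<le> 2" if "p0 \<in> I \<epsilon>" for p0
        using that \<open>I \<epsilon> \<subseteq> {1..2}\<close> by auto
      ultimately show "Cantor_type_set (I \<epsilon>) \<and> I \<epsilon> \<subseteq> {1..2} \<and>
           (\<forall>p0 \<in> I \<epsilon>.
              solves_nlw \<alpha> \<rho> 0 (cos_wave m0 (sqrt ((norm (real_vec m0))\<^sup>2 + \<rho>)) p0) \<and>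
              (\<exists>\<omega>. persists_with_frequency 1 c \<alpha> \<rho> \<epsilon> m0 p0 \<omega> \<and>
                   \<bar>\<omega>\<^sup>2 - ((norm (real_vec m0))\<^sup>2 + \<rho>
                          + 3 / 4 * bracket m0 powr \<alpha> * p0\<^sup>2 * \<epsilon>\<^sup>2)\<bar>
                     \<le> K * \<epsilon> powr (17 / 8)))"
        using \<epsilon> per[of \<epsilon>] cos_wave_solves_linear[OF assms 1(1)] by auto
    qed
    ultimately show ?thesis using \<epsilon>0
      by (intro exI[of _ "min \<epsilon>0 1"] exI[of _ K] exI[of _ I] conjI) auto
  qed
  show ?case
    by (intro exI[of _ "1::real"] conjI allI impI core) auto
qed

end
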